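(* In both the Dunkl case and the hybrid Dunkl-Bessel case the following holds. For $x,w\in\mathbb{R}$ and $t>0$ let $y_{x,w,t}=\sqrt{x^2+w^2t^2+2t\sqrt{x^2w^2+1}}$, and let $q_{x,w,t}$ be $$q_{x,w,t}=\widetilde h(x\,y_{x,w,t}/t)\,\widetilde h(w\,y_{x,w,t})\ \text{ in the Dunkl case},\qquad q_{x,w,t}=\widetilde h(x\,y_{x,w,t}/t)\ \text{ in the hybrid Dunkl-Bessel case}.$$ Put $a_{x,w,t}:=q_{x,w,t}/(1+q_{x,w,t})$ and $b_{x,w,t}:=1/(1+q_{x,w,t})$. Then, for $k\to\infty$, the probability measures $K^{kw}_{t/k,k}(x,\cdot)$ converge weakly to $a_{x,w,t}\,\delta_{y_{x,w,t}}+b_{x,w,t}\,\delta_{-y_{x,w,t}}$, locally uniformly with respect to $x,w\in\mathbb{R}$ and $t>0$; that is, for all compact sets $U\subset\mathbb{R}\times\mathbb{R}\times\,]0,\infty[$, $$\sup_{(x,w,t)\in U}d_P\big(K^{kw}_{t/k,k}(x,\cdot),\ a_{x,w,t}\,\delta_{y_{x,w,t}}+b_{x,w,t}\,\delta_{-y_{x,w,t}}\big)\ \longrightarrow\ 0\qquad\text{for } k\to\infty.$$ Here $K^{kw}_{t/k,k}$ stands for $K^{Dunkl,kw}_{t/k,k}$ in the Dunkl case and for $K^{DuBe,kw}_{t/k,k}$ in the hybrid case.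
   Context: For $k>0$, the one-dimensional Dunkl kernel is $E_k(x,y)=\frac{\Gamma(k+1/2)}{\Gamma(1/2)\Gamma(k)}\int_{-1}^1e^{xyt}(1-t)^{k-1}(1+t)^k\,dt$, and the one-dimensional Bessel function is $J_k(x,y)=\frac{\Gamma(k+1/2)}{\sqrt\pi\,\Gamma(k)}\int_{-1}^1e^{xyt}(1-t^2)^{k-1}\,dt$. For multiplicity $k$, drift $w\in\mathbb{R}$, $t>0$, $x\in\mathbb{R}$ and Borel sets $A\subset\mathbb{R}$, the transition probabilities of the one-dimensional Dunkl process with drift and of the hybrid Dunkl-Bessel process with drift (Feller processes on $\mathbb{R}$) are $$K^{Dunkl,w}_{t,k}(x,A)=\frac{e^{-w^2t/2}}{(2t)^{k+1/2}\Gamma(k+1/2)}\int_A e^{-(x^2+y^2)/(2t)}\,\frac{E_k(\frac{x}{\sqrt t},\frac{y}{\sqrt t})E_k(y,w)}{E_k(x,w)}\,|y|^{2k}\,dy,$$ $$K^{DuBe,w}_{t,k}(x,A)=\frac{e^{-w^2t/2}}{(2t)^{k+1/2}\Gamma(k+1/2)}\int_A e^{-(x^2+y^2)/(2t)}\,\frac{E_k(\frac{x}{\sqrt t},\frac{y}{\sqrt t})J_k(y,w)}{J_k(x,w)}\,|y|^{2k}\,dy.$$ $h(z)=z/(\sqrt{z^2+1}+1)$ and $\widetilde h(z)=(1+h(z))/(1-h(z))$ for $z\in\mathbb{R}$. $d_P$ is the Prohorov metric on the probability measures on $\mathbb{R}$: $d_P(\mu,\nu)=\inf\{\epsilon>0:\mu(B)\le\nu(B^\epsilon)+\epsilon\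 \text{for all Borel }B\subset\mathbb{R}\}$ with $B^\epsilon=\{x\in\mathbb{R}: d(x,B)<\epsilon\}$. *)

theory Defs
  imports "HOL-Probability.Probability"
begin

definition dunkl_E :: "real \<Rightarrow> real \<Rightarrow> real \<Rightarrow> real" where
  "dunkl_E k x y = Gamma (k + 1/2) / (Gamma (1/2) * Gamma k) *
     (LINT s:{-1..1}|lborel. exp (x * y * s) * (1 - s) powr (k - 1) * (1 + s) powr k)"

definition bessel_J :: "real \<Rightarrow> real \<Rightarrow> real \<Rightarrow> real" where
  "bessel_J k x y = Gamma (k + 1/2) / (sqrt pi * Gamma k) *
     (LINT s:{-1..1}|lborel. exp (x * y * s) * (1 - s\<^sup>2) powr (k - 1))"

text \<open>The transition probabilities \<open>A \<mapsto> K\<^bsub>t,k\<^esub>\<^bsup>w\<^esup>(x, A)\<close> as measures on the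
  Borel sets, for \<open>k, t > 0\<close>. The arguments are, in this order, the multiplicity \<open>k\<close>,
  the drift \<open>w\<close>, the time \<open>t\<close> and the starting point \<open>x\<close>.\<close>

definition dunkl_kernel :: "real \<Rightarrow> real \<Rightarrow> real \<Rightarrow> real \<Rightarrow> real measure" where
  "dunkl_kernel k w t x = density lborel (\<lambda>y. ennreal (
     exp (- (w\<^sup>2 * t / 2)) / ((2 * t) powr (k + 1/2) * Gamma (k + 1/2)) *
     (exp (- ((x\<^sup>2 + y\<^sup>2) / (2 * t))) *
      (dunkl_E k (x / sqrt t) (y / sqrt t) * dunkl_E k y w / dunkl_E k x w) *
      \<bar>y\<bar> powr (2 * k))))"

definition dunkl_bessel_kernel :: "real \<Rightarrow> real \<Rightarrow> real \<Rightarrow> real \<Rightarrow> real measure" where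
  "dunkl_bessel_kernel k w t x = density lborel (\<lambda>y. ennreal (
     exp (- (w\<^sup>2 * t / 2)) / ((2 * t) powr (k + 1/2) * Gamma (k + 1/2)) *
     (exp (- ((x\<^sup>2 + y\<^sup>2) / (2 * t))) *
      (dunkl_E k (x / sqrt t) (y / sqrt t) * bessel_J k y w / bessel_J k x w) *
      \<bar>y\<bar> powr (2 * k))))"

definition h_fun :: "real \<Rightarrow> real" where
  "h_fun z = z / (sqrt (z\<^sup>2 + 1) + 1)"

definition h_tilde :: "real \<Rightarrow> real" where
  "h_tilde z = (1 + h_fun z) / (1 - h_fun z)"

definition y_lim :: "real \<Rightarrow> real \<Rightarrow> real \<Rightarrow> real" where
  "y_lim x w t = sqrt (x\<^sup>2 + w\<^sup>2 * t\<^sup>2 + 2 * t * sqrt (x\<^sup>2 * w\<^sup>2 + 1))"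

definition q_dunkl :: "real \<Rightarrow> real \<Rightarrow> real \<Rightarrow> real" where
  "q_dunkl x w t = h_tilde (x * y_lim x w t / t) * h_tilde (w * y_lim x w t)"

definition q_dunkl_bessel :: "real \<Rightarrow> real \<Rightarrow> real \<Rightarrow> real" where
  "q_dunkl_bessel x w t = h_tilde (x * y_lim x w t / t)"

text \<open>The measure \<open>a \<delta>\<^sub>y + b \<delta>\<^sub>z\<close> on the Borel sets of the real line.\<close>

definition dirac_comb :: "real \<Rightarrow> real \<Rightarrow> real \<Rightarrow> real \<Rightarrow> real measure" where
  "dirac_comb a y b z = measure_of UNIV (sets borel)
     (\<lambda>A. ennreal a * emeasure (return borel y) A + ennreal b * emeasure (return borel z) A)"

lemma sets_dirac_comb [simp]: "sets (dirac_comb a y b z) = sets borel"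
  unfolding dirac_comb_def
  by (metis sets.sets_measure_of_eq space_borel)

lemma emeasure_dirac_comb:
  assumes "A \<in> sets borel"
  shows "emeasure (dirac_comb a y b z) A =
    ennreal a * emeasure (return borel y) A + ennreal b * emeasure (return borel z) A"
proof (rule emeasure_measure_of[OF dirac_comb_def])
  show "countably_additive (sets (dirac_comb a y b z))
    (\<lambda>A. ennreal a * emeasure (return borel y) A + ennreal b * emeasure (return borel z) A)"
  proof (rule countably_additiveI)
    fix F :: "nat \<Rightarrow> real set"
    assume F: "range F \<subseteq> sets (dirac_comb a y b z)" "disjoint_family F"
    then show "(\<Sum>i. ennreal a * emeasure (return borel y) (F i) +
        ennreal b * emeasure (return borel z) (F i)) =
      ennreal a * emeasure (return borel y) (\<Union>i. F i) +
        ennreal b * emeasure (return borel z) (\<Union>i. F i)"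
      by (simp add: suminf_add[symmetric] suminf_emeasure del: emeasure_return)
  qed
qed (use assms in \<open>auto simp: positive_def\<close>)

text \<open>With the convention \<open>d(x, {}) = \<infinity>\<close> (unlike \<^const>\<open>infdist\<close>, which is 0 there),
  \<open>d(x, B) < e\<close> says that some point of \<open>B\<close> has distance less than \<open>e\<close> from \<open>x\<close>.\<close>

definition nbhd_set :: "real \<Rightarrow> real set \<Rightarrow> real set" where
  "nbhd_set e B = {x. \<exists>y\<in>B. dist x y < e}"

definition prohorov_dist :: "real measure \<Rightarrow> real measure \<Rightarrow> real" where
  "prohorov_dist M N =
     Inf {e. e > 0 \<and> (\<forall>B\<in>sets borel. measure M B \<le> measure N (nbhd_set e B) + e)}"

end

theory Submission
  imports Defs
begin

text \<open>
Both kernels are perturbations of one symmetric probability density. On \<open>[-1,1]\<close> consider the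
probability measure with density proportional to \<open>exp (z s) (1 - s\<^sup>2)\<^sup>k\<^sup>-\<^sup>1\<close>, and let \<open>m(z)\<close> be its mean.
Then \<open>E\<^sub>k(x,y) = J\<^sub>k(x,y) (1 + m(xy))\<close>. Hence, for the rescaled parameters \<open>kw\<close> and \<open>t/k\<close>, the Dunkl
density is the density \<open>f\<close> obtained by replacing all three factors \<open>E\<^sub>k\<close> by \<open>J\<^sub>k\<close>, multiplied by
\<open>(1 + m(kxy/t)) (1 + m(kwy)) / (1 + m(kxw))\<close>, and in the hybrid case the multiplier is \<open>1 + m(kxy/t)\<close>.
Three facts then give the limit.

The means converge. The exponent \<open>zs + ln (1 - s\<^sup>2)\<close> is maximal at \<open>s = h(z)\<close>, and a single
integration by parts bounds the second moment about this point by \<open>1/k\<close>, for every real \<open>z\<close>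
(\<open>bessel_concentration\<close>). So \<open>m(kz)\<close> differs from \<open>h(z)\<close> by at most \<open>k\<^sup>-\<^sup>1\<^sup>/\<^sup>2\<close> (\<open>bessel_mean_approx\<close>).

The symmetric density concentrates. It is even in \<open>y\<close>, and Weber's second exponential integral
(\<open>weber_second_exponential_integral\<close>) shows that its total mass is 1 and gives its integral against
\<open>exp (c y\<^sup>2)\<close> in closed form. Besides elementary factors it contains only a quotient of two values of \<open>J\<^sub>k\<close>, which
is controlled by the means \<open>m\<close> through Jensen's inequality, so Chernoff's method applies: the
density puts mass tending to 0 on the set where \<open>y\<^sup>2\<close> is not close to the square of the limit point
(\<open>bessel_density_tail_uniform\<close>). By symmetry, mass close to \<open>1/2\<close> sits near each of \<open>y\<close> and \<open>-y\<close>.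

The constants agree. At \<open>y = y\<^sub>x\<^sub>,\<^sub>w\<^sub>,\<^sub>t\<close> put \<open>u = h(xy/t)\<close> and \<open>v = h(wy)\<close>. Then \<open>u v = h(xw)\<close>
(\<open>h_fun_y_lim\<close>), so the multipliers at \<open>\<plusminus>y\<close> tend to \<open>(1 \<plusminus> u) (1 \<plusminus> v) / (1 + u v)\<close>. Half of these
numbers are the two weights of the theorem, because \<open>(1 + u) (1 + v) + (1 - u) (1 - v) = 2 (1 + u v)\<close>.
In the hybrid case the multipliers tend to \<open>1 \<plusminus> u\<close>.

All estimates are explicit in a number \<open>L\<close> with \<open>|x|, |w| \<le> L\<close> and \<open>1/L \<le> t \<le> L\<close>, which gives the
uniformity on compact sets. The series proof of Weber's integral rests on Vandermonde's convolution
(\<open>Gamma_Vandermonde\<close>).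
\<close>

section \<open>The function h and the limit points\<close>

lemma h_fun_mult: "z * h_fun z = sqrt (z\<^sup>2 + 1) - 1"
proof -
  have "sqrt (z\<^sup>2 + 1) + 1 > 0" by (simp add: add_nonneg_pos)
  moreover have "z * z = (sqrt (z\<^sup>2 + 1) - 1) * (sqrt (z\<^sup>2 + 1) + 1)"
    by (simp add: algebra_simps flip: power2_eq_square)
  ultimately show ?thesis
    unfolding h_fun_def by (simp add: field_simps)
qed

text \<open>
The quadratic equation says that \<open>h z\<close> is the critical point of \<open>z s + ln (1 - s\<^sup>2)\<close> on \<open>(-1,1)\<close>.
\<close>

lemma h_fun_quadratic: "z * (h_fun z)\<^sup>2 + 2 * h_fun z - z = 0"
proof -
  define r where "r = sqrt (z\<^sup>2 + 1)"
  have r: "r + 1 > 0" by (simp add: add_nonneg_pos r_def)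
  have "z * (h_fun z)\<^sup>2 = (r - 1) * h_fun z"
    using h_fun_mult[of z] by (simp add: r_def power2_eq_square)
  then have "z * (h_fun z)\<^sup>2 + 2 * h_fun z - z = (r + 1) * h_fun z - z"
    by (simp add: algebra_simps)
  also have "\<dots> = 0" using r by (simp add: h_fun_def r_def)
  finally show ?thesis .
qed

lemma h_fun_bound: "\<bar>h_fun z\<bar> < 1"
proof -
  have "\<bar>z\<bar> \<le> sqrt (z\<^sup>2 + 1)" by (rule real_le_rsqrt) simp
  then have "\<bar>z\<bar> < sqrt (z\<^sup>2 + 1) + 1" by simp
  moreover have "sqrt (z\<^sup>2 + 1) + 1 > 0" by (simp add: add_nonneg_pos)
  ultimately show ?thesis by (simp add: h_fun_def abs_divide)
qed

lemma h_fun_lower: "1 + h_fun z \<ge> 1 / (\<bar>z\<bar> + 2)"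
proof -
  define r where "r = sqrt (z\<^sup>2 + 1)"
  have r: "\<bar>z\<bar> \<le> r" unfolding r_def by (rule real_le_rsqrt) simp
  have "r \<le> \<bar>z\<bar> + 1" unfolding r_def by (rule real_le_lsqrt) (auto simp: power2_eq_square algebra_simps)
  then have "1 / (\<bar>z\<bar> + 2) \<le> 1 / (r + 1)" using r by (intro divide_left_mono) auto
  also have "\<dots> \<le> (r + 1 + z) / (r + 1)" using r by (intro divide_right_mono) auto
  also have "\<dots> = 1 + h_fun z" using r by (simp add: h_fun_def r_def field_simps)
  finally show ?thesis .
qed

text \<open>
Solving the quadratic equation for \<open>z\<close> gives \<open>z = 2 h / (1 - h\<^sup>2)\<close>, and the difference quotient of
this inverse function is at least 1.
\<close>

lemma h_fun_lipschitz: "\<bar>h_fun a - h_fun b\<bar> \<le> \<bar>a - b\<bar>"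
proof -
  define u v where "u = h_fun a" and "v = h_fun b"
  have "u\<^sup>2 < 1" "v\<^sup>2 < 1"
    using h_fun_bound[of a] h_fun_bound[of b] by (auto simp: u_def v_def abs_square_less_1)
  then have D: "1 - u\<^sup>2 > 0" "1 - v\<^sup>2 > 0" by auto
  have a: "a = 2 * u / (1 - u\<^sup>2)" and b: "b = 2 * v / (1 - v\<^sup>2)"
    using D h_fun_quadratic[of a] h_fun_quadratic[of b] by (simp_all add: u_def v_def field_simps)
  define c where "c = 2 * (1 + u * v) / ((1 - u\<^sup>2) * (1 - v\<^sup>2))"
  have "a - b = (u - v) * c"
    unfolding a b c_def using D by (simp add: field_simps) (simp add: algebra_simps power2_eq_square)
  moreover have "c \<ge> 1"
  proof -
    have "u\<^sup>2 * v\<^sup>2 \<le> 1 * 1" using D by (intro mult_mono) auto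
    moreover have "(u + v)\<^sup>2 \<ge> 0" by simp
    ultimately have "(1 - u\<^sup>2) * (1 - v\<^sup>2) \<le> 2 * (1 + u * v)"
      by (simp add: algebra_simps power2_eq_square)
    then show ?thesis using D by (simp add: c_def)
  qed
  then have "\<bar>u - v\<bar> * 1 \<le> \<bar>u - v\<bar> * \<bar>c\<bar>"
    by (intro mult_left_mono) auto
  ultimately show ?thesis by (simp add: abs_mult u_def v_def)
qed

lemma y_lim_sq:
  assumes "t > 0"
  shows "(y_lim x w t)\<^sup>2 = x\<^sup>2 + w\<^sup>2 * t\<^sup>2 + 2 * t * sqrt (x\<^sup>2 * w\<^sup>2 + 1)"
  unfolding y_lim_def using assms by (intro real_sqrt_pow2 add_nonneg_nonneg mult_nonneg_nonneg) auto

text \<open>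
With \<open>s = sqrt (x\<^sup>2 w\<^sup>2 + 1)\<close>, both square roots on the left are rational in \<open>s\<close>, because
\<open>(xy/t)\<^sup>2 + 1 = (s + x\<^sup>2/t)\<^sup>2\<close> and \<open>(wy)\<^sup>2 + 1 = (s + w\<^sup>2 t)\<^sup>2\<close>; the product of the two denominators is
then \<open>(s + 1) y\<^sup>2 / t\<close>.
\<close>

lemma h_fun_y_lim:
  assumes t: "t > 0"
  shows "h_fun (x * y_lim x w t / t) * h_fun (w * y_lim x w t) = h_fun (x * w)"
proof -
  define s where "s = sqrt (x\<^sup>2 * w\<^sup>2 + 1)"
  define y where "y = y_lim x w t"
  have s2: "s\<^sup>2 = x\<^sup>2 * w\<^sup>2 + 1" and s0: "s \<ge> 1"
    unfolding s_def by (auto intro!: real_sqrt_pow2 add_nonneg_nonneg)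
  have y2: "y\<^sup>2 = x\<^sup>2 + w\<^sup>2 * t\<^sup>2 + 2 * t * s"
    unfolding y_def s_def by (rule y_lim_sq[OF t])
  have "(x * y / t)\<^sup>2 + 1 = (s + x\<^sup>2 / t)\<^sup>2"
    using t by (simp add: power_mult_distrib power_divide y2 power2_sum s2) (simp add: field_simps power2_eq_square power4_eq_xxxx)
  then have 1: "sqrt ((x * y / t)\<^sup>2 + 1) = s + x\<^sup>2 / t"
    using s0 t by (simp add: real_sqrt_abs)
  have "(w * y)\<^sup>2 + 1 = (s + w\<^sup>2 * t)\<^sup>2"
    by (simp add: power_mult_distrib y2 power2_sum s2) (simp add: field_simps power2_eq_square power4_eq_xxxx)
  then have 2: "sqrt ((w * y)\<^sup>2 + 1) = s + w\<^sup>2 * t"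
    using s0 t by (simp add: real_sqrt_abs)
  have 3: "sqrt ((x * w)\<^sup>2 + 1) = s" by (simp add: s_def power_mult_distrib)
  have pos: "s + x\<^sup>2 / t + 1 > 0" "s + w\<^sup>2 * t + 1 > 0" "s + 1 > 0"
    using s0 t by (auto intro!: add_nonneg_pos add_nonneg_nonneg)
  have ypos: "y\<^sup>2 > 0" unfolding y2 using s0 t by (intro add_nonneg_pos) auto
  have "t * ((s + x\<^sup>2 / t + 1) * (s + w\<^sup>2 * t + 1)) = (s + 1) * y\<^sup>2"
  proof -
    have "t * ((s + x\<^sup>2 / t + 1) * (s + w\<^sup>2 * t + 1)) =
        t * (s + 1)\<^sup>2 + (s + 1) * (x\<^sup>2 + w\<^sup>2 * t\<^sup>2) + t * (x\<^sup>2 * w\<^sup>2)"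
      using t by (simp add: field_simps power2_eq_square)
    also have "x\<^sup>2 * w\<^sup>2 = s\<^sup>2 - 1" by (simp add: s2)
    finally show ?thesis unfolding y2 by (simp add: algebra_simps power2_eq_square)
  qed
  then have "h_fun (x * y / t) * h_fun (w * y) = x * w * y\<^sup>2 / ((s + 1) * y\<^sup>2)"
    unfolding h_fun_def 1 2 by (simp add: power2_eq_square mult_ac)
  also have "\<dots> = h_fun (x * w)" using ypos pos unfolding h_fun_def 3 by simp
  finally show ?thesis unfolding y_def .
qed

lemma h_fun_minus: "h_fun (- z) = - h_fun z"
  by (simp add: h_fun_def)

text \<open>
The weights of the limit in the form in which they arise as limits of the multiplier of the
symmetric density, at the positive and at the negative limit point.
\<close>

lemma weights_dunkl:
  fixes x w t :: real
  assumes t: "t > 0"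
  defines "u \<equiv> h_fun (x * y_lim x w t / t)" and "v \<equiv> h_fun (w * y_lim x w t)"
  shows "2 * (q_dunkl x w t / (1 + q_dunkl x w t)) = (1 + u) * (1 + v) / (1 + h_fun (x * w))"
    "2 * (1 / (1 + q_dunkl x w t)) = (1 - u) * (1 - v) / (1 + h_fun (x * w))"
proof -
  have uv: "u * v = h_fun (x * w)" unfolding u_def v_def by (rule h_fun_y_lim[OF t])
  have b: "\<bar>u\<bar> < 1" "\<bar>v\<bar> < 1" unfolding u_def v_def by (rule h_fun_bound)+
  define p m where "p = (1 + u) * (1 + v)" and "m = (1 - u) * (1 - v)"
  have pm: "p > 0" "m > 0" using b unfolding p_def m_def by (auto intro!: mult_pos_pos)
  have s: "p + m = 2 * (1 + h_fun (x * w))" unfolding uv[symmetric] p_def m_def by (simp add: algebra_simps)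
  have q: "q_dunkl x w t = p / m"
    unfolding q_dunkl_def h_tilde_def u_def[symmetric] v_def[symmetric] p_def m_def by simp
  have h: "1 + h_fun (x * w) = (p + m) / 2" using s by simp
  show "2 * (q_dunkl x w t / (1 + q_dunkl x w t)) = (1 + u) * (1 + v) / (1 + h_fun (x * w))"
    unfolding q p_def[symmetric] h using pm by (simp add: field_simps)
  show "2 * (1 / (1 + q_dunkl x w t)) = (1 - u) * (1 - v) / (1 + h_fun (x * w))"
    unfolding q m_def[symmetric] h using pm by (simp add: field_simps)
qed

lemma weights_dunkl_bessel:
  fixes x w t :: real
  defines "u \<equiv> h_fun (x * y_lim x w t / t)"
  shows "2 * (q_dunkl_bessel x w t / (1 + q_dunkl_bessel x w t)) = 1 + u"
    "2 * (1 / (1 + q_dunkl_bessel x w t)) = 1 - u"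
proof -
  have b: "\<bar>u\<bar> < 1" unfolding u_def by (rule h_fun_bound)
  then have q: "q_dunkl_bessel x w t = (1 + u) / (1 - u)" "1 - u > 0"
    unfolding q_dunkl_bessel_def h_tilde_def u_def[symmetric] by auto
  have "1 + (1 + u) / (1 - u) = 2 / (1 - u)" using q by (simp add: field_simps)
  then show "2 * (q_dunkl_bessel x w t / (1 + q_dunkl_bessel x w t)) = 1 + u"
    "2 * (1 / (1 + q_dunkl_bessel x w t)) = 1 - u"
    unfolding q(1) using q(2) by simp_all
qed

text \<open>
Crude bounds that make the later estimates uniform in the parameters. The quotient of \<open>y\<^sup>2\<close> by \<open>2t\<close>
is the coefficient of the quadratic term in the tail bound \<open>bessel_density_tail\<close>.
\<close>

lemma y_lim_bounds:
  assumes L: "L \<ge> 1" and x: "\<bar>x\<bar> \<le> L" and w: "\<bar>w\<bar> \<le> L" and t: "1 / L \<le> t" "t \<le> L"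
  shows "t > 0" "(y_lim x w t)\<^sup>2 / (2 * t) \<le> 3 * L ^ 3" "1 / L \<le> y_lim x w t" "1 / L \<le> (y_lim x w t)\<^sup>2"
    "\<bar>x * w\<bar> \<le> L\<^sup>2" "\<bar>x / t\<bar> \<le> L\<^sup>2"
proof -
  show tp: "t > 0" using t(1) L by (meson divide_pos_pos less_le_trans zero_less_one)
  have tL: "1 / t \<le> L" using t(1) tp L by (simp add: field_simps)
  show xw: "\<bar>x * w\<bar> \<le> L\<^sup>2"
    unfolding abs_mult power2_eq_square using x w L by (intro mult_mono) auto
  have "\<bar>x\<bar> * (1 / t) \<le> L * L"
    using x tL tp L by (intro mult_mono) auto
  then show "\<bar>x / t\<bar> \<le> L\<^sup>2" using tp by (simp add: power2_eq_square)
  have x2: "x\<^sup>2 \<le> L\<^sup>2" and w2: "w\<^sup>2 \<le> L\<^sup>2"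
    using x w L by (simp_all add: abs_le_square_iff[symmetric])
  have "x\<^sup>2 * (1 / t) \<le> L\<^sup>2 * L" using x2 tL tp L by (intro mult_mono) auto
  moreover have "w\<^sup>2 * t \<le> L\<^sup>2 * L" using w2 t tp L by (intro mult_mono) auto
  ultimately have 1: "(x\<^sup>2 * (1 / t) + w\<^sup>2 * t) / 2 \<le> L ^ 3" by (simp add: power3_eq_cube power2_eq_square)
  have "sqrt (x\<^sup>2 * w\<^sup>2 + 1) \<le> 1 + L\<^sup>2"
  proof (rule real_le_lsqrt)
    have "x\<^sup>2 * w\<^sup>2 \<le> L\<^sup>2 * L\<^sup>2" using x2 w2 by (intro mult_mono) auto
    moreover have "L\<^sup>2 \<ge> 0" by simp
    ultimately show "x\<^sup>2 * w\<^sup>2 + 1 \<le> (1 + L\<^sup>2)\<^sup>2"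
      unfolding power2_sum power2_eq_square[of "L\<^sup>2"] one_power2 by linarith
  qed (use L in simp)
  moreover have "1 \<le> L ^ 3" "L\<^sup>2 \<le> L ^ 3" using L by (auto intro!: one_le_power power_increasing)
  ultimately have 2: "sqrt (x\<^sup>2 * w\<^sup>2 + 1) \<le> 2 * L ^ 3" by linarith
  have "(y_lim x w t)\<^sup>2 / (2 * t) = (x\<^sup>2 * (1 / t) + w\<^sup>2 * t) / 2 + sqrt (x\<^sup>2 * w\<^sup>2 + 1)"
    unfolding y_lim_sq[OF tp] using tp by (simp add: field_simps power2_eq_square)
  then show "(y_lim x w t)\<^sup>2 / (2 * t) \<le> 3 * L ^ 3" using 1 2 by linarith
  have "t * 1 \<le> t * sqrt (x\<^sup>2 * w\<^sup>2 + 1)" using tp by (intro mult_left_mono) auto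
  moreover have "0 \<le> w\<^sup>2 * t\<^sup>2" "0 \<le> x\<^sup>2" by simp_all
  ultimately have "t \<le> (y_lim x w t)\<^sup>2" unfolding y_lim_sq[OF tp] using tp by linarith
  then show ge: "1 / L \<le> (y_lim x w t)\<^sup>2" using t by linarith
  have "(1 / L)\<^sup>2 \<le> 1 / L" using L by (simp add: power2_eq_square divide_simps)
  then have "(1 / L)\<^sup>2 \<le> (y_lim x w t)\<^sup>2" using ge by linarith
  moreover have "y_lim x w t \<ge> 0" unfolding y_lim_def using tp
    by (intro real_sqrt_ge_zero add_nonneg_nonneg mult_nonneg_nonneg) auto
  ultimately show "1 / L \<le> y_lim x w t" by (rule power2_le_imp_le)
qed

section \<open>The measures underlying the Bessel function and their means\<close>

definition bessel_weight :: "real \<Rightarrow> real \<Rightarrow> real \<Rightarrow> real" where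
  "bessel_weight k z s = exp (z * s) * (1 - s\<^sup>2) powr (k - 1)"

text \<open>
The mean of the probability measure on \<open>[-1,1]\<close> with density proportional to the weight; it is also
the logarithmic derivative of the Bessel function.
\<close>

definition bessel_mean :: "real \<Rightarrow> real \<Rightarrow> real" where
  "bessel_mean k z = integral {-1..1} (\<lambda>s. s * bessel_weight k z s) / integral {-1..1} (bessel_weight k z)"

lemma bessel_weight_nonneg: "bessel_weight k z s \<ge> 0"
  by (simp add: bessel_weight_def)

lemma continuous_on_bessel_weight:
  assumes "k > 1"
  shows "continuous_on {-1..1} (bessel_weight k z)"
proof -
  have "continuous_on {-1..1} (\<lambda>s::real. (1 - s\<^sup>2) powr (k - 1))"
    using assms by (intro continuous_on_powr' continuous_on_diff continuous_on_power
        continuous_on_const continuous_on_id) (auto simp: abs_square_le_1)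
  then show ?thesis
    unfolding bessel_weight_def by (intro continuous_on_mult continuous_on_exp continuous_on_const continuous_on_id)
qed

lemma bessel_weight_integrable:
  assumes "k > 1" "continuous_on {-1..1} f"
  shows "(\<lambda>s. f s * bessel_weight k z s) integrable_on {-1..1}"
  using assms by (intro integrable_continuous_real continuous_on_mult continuous_on_bessel_weight)

lemma bessel_weight_integral_pos:
  assumes k: "k > 1"
  shows "integral {-1..1} (bessel_weight k z) > 0"
proof -
  have "integral {-1..1} (bessel_weight k z) \<noteq> 0"
  proof
    assume "integral {-1..1} (bessel_weight k z) = 0"
    then have "bessel_weight k z 0 = 0"
      using integral_eq_0_iff[OF continuous_on_bessel_weight[OF k, of z]] bessel_weight_nonneg by simp
    then show False by (simp add: bessel_weight_def)
  qed
  moreover have "integral {-1..1} (bessel_weight k z) \<ge> 0"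
    using bessel_weight_nonneg bessel_weight_integrable[OF k, of "\<lambda>_. 1" z]
    by (intro integral_nonneg) auto
  ultimately show ?thesis by simp
qed

text \<open>
Integrate the derivative of \<open>F(s) = (s - u) exp (k z s) (1 - s\<^sup>2)\<^sup>k\<close> with \<open>u = h z\<close>; it has integral 0,
since \<open>F\<close> vanishes at both end points. As \<open>u\<close> is a root of \<open>z s\<^sup>2 + 2 s - z\<close>, this quadratic is
\<open>(s - u) (2 + z (s + u))\<close>, and the identity becomes: the integral of \<open>1 - s\<^sup>2\<close> equals \<open>k\<close> times the
integral of \<open>(s - u)\<^sup>2 (2 + z (s + u))\<close>, both against the weight. The last factor is at least 1, uniformly in \<open>z\<close>.
\<close>

lemma bessel_concentration:
  assumes k: "k > 1"
  shows "k * integral {-1..1} (\<lambda>s. (s - h_fun z)\<^sup>2 * bessel_weight k (k * z) s) \<le>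
         integral {-1..1} (bessel_weight k (k * z))"
proof -
  define u where "u = h_fun z"
  let ?w = "bessel_weight k (k * z)"
  let ?F = "\<lambda>s. (s - u) * (exp (k * z * s) * (1 - s\<^sup>2) powr k)"
  let ?G = "\<lambda>s. (1 - s\<^sup>2 - k * ((s - u)\<^sup>2 * (2 + z * (s + u))))"
  have quad: "z * u\<^sup>2 + 2 * u - z = 0" unfolding u_def by (rule h_fun_quadratic)
  have "((\<lambda>s. ?G s * ?w s) has_integral (?F 1 - ?F (-1))) {-1..1}"
  proof (rule fundamental_theorem_of_calculus_interior)
    show "continuous_on {-1..1} ?F"
    proof -
      have "continuous_on {-1..1} (\<lambda>s::real. (1 - s\<^sup>2) powr k)"
        using assms by (intro continuous_on_powr' continuous_on_diff continuous_on_power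
            continuous_on_const continuous_on_id) (auto simp: abs_square_le_1)
      then show ?thesis
        by (intro continuous_on_mult continuous_on_diff continuous_on_exp continuous_on_const continuous_on_id)
    qed
    fix s :: real assume "s \<in> {-1<..<1}"
    then have s: "1 - s\<^sup>2 > 0" by (simp add: abs_square_less_1 abs_less_iff)
    have d1: "((\<lambda>s. (1 - s\<^sup>2) powr k) has_real_derivative k * (1 - s\<^sup>2) powr (k - of_nat 1) * (- (2 * s))) (at s)"
      by (rule DERIV_fun_powr[where g="\<lambda>s. 1 - s\<^sup>2", OF _ s]) (auto intro!: derivative_eq_intros)
    have d2: "((\<lambda>s. exp (k * z * s)) has_real_derivative exp (k * z * s) * (k * z)) (at s)"
      by (auto intro!: derivative_eq_intros)
    have d3: "((\<lambda>s. s - u) has_real_derivative 1) (at s)"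
      by (auto intro!: derivative_eq_intros)
    have "(?F has_real_derivative 1 * (exp (k * z * s) * (1 - s\<^sup>2) powr k) +
       (exp (k * z * s) * (k * z) * (1 - s\<^sup>2) powr k + (k * (1 - s\<^sup>2) powr (k - of_nat 1) * (- (2 * s))) * exp (k * z * s)) * (s - u)) (at s)"
      by (rule DERIV_mult'[OF d3 DERIV_mult'[OF d2 d1], THEN DERIV_cong]) (simp add: algebra_simps)
    moreover have "1 * (exp (k * z * s) * (1 - s\<^sup>2) powr k) +
       (exp (k * z * s) * (k * z) * (1 - s\<^sup>2) powr k + (k * (1 - s\<^sup>2) powr (k - of_nat 1) * (- (2 * s))) * exp (k * z * s)) * (s - u)
        = ?G s * ?w s"
    proof -
      define e where "e = exp (k * z * s)"
      define p where "p = (1 - s\<^sup>2) powr (k - 1)"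
      have pk: "(1 - s\<^sup>2) powr k = (1 - s\<^sup>2) * p"
        using s powr_mult_base[of "1 - s\<^sup>2" "k - 1"] by (simp add: p_def)
      have w: "?w s = e * p" by (simp add: bessel_weight_def e_def p_def)
      have fac: "z * (1 - s\<^sup>2) - 2 * s = - ((s - u) * (2 + z * (s + u)))"
        using quad by (simp add: algebra_simps power2_eq_square)
      have "1 * (e * ((1 - s\<^sup>2) * p)) + (e * (k * z) * ((1 - s\<^sup>2) * p) + (k * p * (- (2 * s))) * e) * (s - u) =
         ((1 - s\<^sup>2) + k * (s - u) * (z * (1 - s\<^sup>2) - 2 * s)) * (e * p)"
        by (simp add: algebra_simps)
      also have "\<dots> = ?G s * (e * p)"
        unfolding fac by (simp add: algebra_simps power2_eq_square)
      finally show ?thesis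
        unfolding w e_def[symmetric] pk by (simp add: p_def)
    qed
    ultimately show "(?F has_vector_derivative ?G s * ?w s) (at s)"
      by (simp add: has_real_derivative_iff_has_vector_derivative)
  qed simp
  then have zero: "((\<lambda>s. ?G s * ?w s) has_integral 0) {-1..1}"
    using k by simp
  have one: "((\<lambda>s. 1 * ?w s) has_integral integral {-1..1} (\<lambda>s. 1 * ?w s)) {-1..1}"
    by (intro integrable_integral bessel_weight_integrable k continuous_on_const)
  have "(\<lambda>s. (s - u)\<^sup>2 * ?w s) integrable_on {-1..1}"
    by (intro bessel_weight_integrable k continuous_intros)
  then have "((\<lambda>s. k * ((s - u)\<^sup>2 * ?w s)) has_integral k * integral {-1..1} (\<lambda>s. (s - u)\<^sup>2 * ?w s)) {-1..1}"
    by (intro has_integral_mult_right integrable_integral)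
  then have total: "((\<lambda>s. ?G s * ?w s + k * ((s - u)\<^sup>2 * ?w s)) has_integral
      0 + k * integral {-1..1} (\<lambda>s. (s - u)\<^sup>2 * ?w s)) {-1..1}"
    by (rule has_integral_add[OF zero])
  have "0 + k * integral {-1..1} (\<lambda>s. (s - u)\<^sup>2 * ?w s) \<le> integral {-1..1} (\<lambda>s. 1 * ?w s)"
  proof (rule has_integral_le[OF total one])
    fix s :: real assume s: "s \<in> {-1..1}"
    \<comment> \<open>\<open>2 + z u = 1 + sqrt (z\<^sup>2 + 1)\<close>, which compensates \<open>z s\<close> on all of \<open>[-1,1]\<close>\<close>
    have "\<bar>z * s\<bar> \<le> \<bar>z\<bar>" using s by (auto simp: abs_mult intro!: mult_left_le)
    also have "\<bar>z\<bar> \<le> sqrt (z\<^sup>2 + 1)" by (rule real_le_rsqrt) simp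
    finally have "2 + z * (s + u) \<ge> 1"
      using h_fun_mult[of z] by (simp add: u_def algebra_simps)
    then have "(s - u)\<^sup>2 * 1 \<le> (s - u)\<^sup>2 * (2 + z * (s + u))"
      by (rule mult_left_mono) simp
    then have "k * ((s - u)\<^sup>2 * 1) \<le> k * ((s - u)\<^sup>2 * (2 + z * (s + u)))"
      by (rule mult_left_mono) (use k in simp)
    moreover have "s\<^sup>2 \<ge> 0" by (rule zero_le_power2)
    ultimately have "?G s + k * (s - u)\<^sup>2 \<le> 1" by linarith
    then have "(?G s + k * (s - u)\<^sup>2) * ?w s \<le> 1 * ?w s"
      by (rule mult_right_mono) (rule bessel_weight_nonneg)
    then show "?G s * ?w s + k * ((s - u)\<^sup>2 * ?w s) \<le> 1 * ?w s"
      by (simp only: distrib_right mult.assoc)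
  qed
  then show ?thesis by (simp add: u_def)
qed

lemma
  assumes k: "k > 1"
  shows bessel_mean_eq: "integral {-1..1} (\<lambda>s. s * bessel_weight k z s) = bessel_mean k z * integral {-1..1} (bessel_weight k z)"
    and abs_bessel_mean_le_1: "\<bar>bessel_mean k z\<bar> \<le> 1"
proof -
  let ?w = "bessel_weight k z"
  let ?I = "integral {-1..1} ?w"
  have pos: "?I > 0" by (rule bessel_weight_integral_pos[OF k])
  then show eq: "integral {-1..1} (\<lambda>s. s * ?w s) = bessel_mean k z * ?I"
    by (simp add: bessel_mean_def)
  have int1: "?w integrable_on {-1..1}"
    using bessel_weight_integrable[OF k, of "\<lambda>_. 1" z] by simp
  have "norm (integral {-1..1} (\<lambda>s. s * ?w s)) \<le> ?I"
  proof (rule integral_norm_bound_integral)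
    fix s :: real assume "s \<in> {-1..1}"
    then have "\<bar>s\<bar> * ?w s \<le> 1 * ?w s"
      by (intro mult_right_mono bessel_weight_nonneg) auto
    then show "norm (s * ?w s) \<le> ?w s" by (simp add: abs_mult bessel_weight_nonneg)
  qed (use int1 bessel_weight_integrable[OF k continuous_on_id] in auto)
  then have "\<bar>bessel_mean k z\<bar> * ?I \<le> 1 * ?I"
    using pos unfolding eq by (simp add: abs_mult)
  then show "\<bar>bessel_mean k z\<bar> \<le> 1" using pos by (simp only: mult_le_cancel_right_pos)
qed

text \<open>
The squared distance from the mean to a point is at most the second moment about that point.
\<close>

lemma bessel_mean_approx:
  assumes k: "k > 1"
  shows "\<bar>bessel_mean k (k * z) - h_fun z\<bar> \<le> 1 / sqrt k"
proof -
  define u where "u = h_fun z"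
  define m where "m = bessel_mean k (k * z)"
  let ?w = "bessel_weight k (k * z)"
  define I where "I = integral {-1..1} ?w"
  have pos: "I > 0" unfolding I_def by (rule bessel_weight_integral_pos[OF k])
  have I: "((\<lambda>s. ?w s) has_integral I) {-1..1}"
    unfolding I_def using bessel_weight_integrable[OF k, of "\<lambda>_. 1" "k * z"]
    by (simp add: integrable_integral)
  have M1: "((\<lambda>s. s * ?w s) has_integral (m * I)) {-1..1}"
    unfolding I_def m_def bessel_mean_eq[OF k, symmetric]
    by (intro integrable_integral bessel_weight_integrable k continuous_on_id)
  have D: "((\<lambda>s. (s - u)\<^sup>2 * ?w s) has_integral integral {-1..1} (\<lambda>s. (s - u)\<^sup>2 * ?w s)) {-1..1}"
    by (intro integrable_integral bessel_weight_integrable k continuous_intros)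
  have "((\<lambda>s. 2 * (m - u) * (s * ?w s) - (m\<^sup>2 - u\<^sup>2) * ?w s) has_integral 2 * (m - u) * (m * I) - (m\<^sup>2 - u\<^sup>2) * I) {-1..1}"
    by (intro has_integral_diff has_integral_mult_right I M1)
  then have "2 * (m - u) * (m * I) - (m\<^sup>2 - u\<^sup>2) * I \<le> integral {-1..1} (\<lambda>s. (s - u)\<^sup>2 * ?w s)"
  proof (rule has_integral_le[OF _ D])
    fix s :: real
    \<comment> \<open>\<open>(s - u)\<^sup>2 - (s - m)\<^sup>2\<close> is linear in \<open>s\<close> and has average \<open>(m - u)\<^sup>2\<close>\<close>
    have "0 \<le> (s - m)\<^sup>2 * ?w s" by (simp add: bessel_weight_nonneg)
    then show "2 * (m - u) * (s * ?w s) - (m\<^sup>2 - u\<^sup>2) * ?w s \<le> (s - u)\<^sup>2 * ?w s"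
      by (simp add: algebra_simps power2_eq_square)
  qed
  then have "(m - u)\<^sup>2 * I \<le> integral {-1..1} (\<lambda>s. (s - u)\<^sup>2 * ?w s)"
    by (simp add: algebra_simps power2_eq_square)
  then have "k * ((m - u)\<^sup>2 * I) \<le> k * integral {-1..1} (\<lambda>s. (s - u)\<^sup>2 * ?w s)"
    using k by (intro mult_left_mono) auto
  also have "\<dots> \<le> I" unfolding u_def I_def by (rule bessel_concentration[OF k])
  finally have "(k * (m - u)\<^sup>2) * I \<le> 1 * I" by (simp only: mult.assoc mult_1_left)
  then have "k * (m - u)\<^sup>2 \<le> 1" using pos by (simp only: mult_le_cancel_right_pos)
  then have "sqrt (k * (m - u)\<^sup>2) \<le> 1" by simp
  then have "sqrt k * \<bar>m - u\<bar> \<le> 1" by (simp add: real_sqrt_mult)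
  then show ?thesis using k by (simp add: m_def u_def field_simps)
qed

lemma bessel_J_mult: "bessel_J k x y = bessel_J k (x * y) 1"
  by (simp add: bessel_J_def)

lemma bessel_J_eq_integral:
  assumes "k > 1"
  shows "bessel_J k x y = Gamma (k + 1/2) / (sqrt pi * Gamma k) * integral {-1..1} (bessel_weight k (x * y))"
proof -
  have "set_integrable lborel {-1..1} (bessel_weight k (x * y))"
    unfolding set_integrable_def
    by (intro borel_integrable_compact continuous_on_bessel_weight assms) auto
  from set_borel_integral_eq_integral(2)[OF this] show ?thesis
    by (simp add: bessel_J_def bessel_weight_def)
qed

lemma bessel_J_pos:
  assumes k: "k > 1"
  shows "bessel_J k x y > 0"
  using k unfolding bessel_J_eq_integral[OF k]
  by (intro mult_pos_pos divide_pos_pos bessel_weight_integral_pos Gamma_real_pos) auto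

text \<open>
Jensen's inequality for the exponential function: \<open>J(z') / J(z)\<close> is the average of
\<open>exp ((z' - z) s)\<close> under the probability measure of parameter \<open>z\<close>.
\<close>

lemma bessel_J_jensen:
  assumes k: "k > 1"
  shows "bessel_J k z 1 * exp ((z' - z) * bessel_mean k z) \<le> bessel_J k z' 1"
proof -
  let ?w = "bessel_weight k z" and ?m = "bessel_mean k z"
  let ?e = "exp ((z' - z) * ?m)"
  have I: "((\<lambda>s. bessel_weight k \<zeta> s) has_integral integral {-1..1} (bessel_weight k \<zeta>)) {-1..1}" for \<zeta>
    using bessel_weight_integrable[OF k, of "\<lambda>_. 1" \<zeta>] by (simp add: integrable_integral)
  have M1: "((\<lambda>s. s * ?w s) has_integral (?m * integral {-1..1} ?w)) {-1..1}"
    unfolding bessel_mean_eq[OF k, symmetric]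
    by (intro integrable_integral bessel_weight_integrable k continuous_on_id)
  have "((\<lambda>s. ?e * ((1 - (z' - z) * ?m) * ?w s + (z' - z) * (s * ?w s))) has_integral
      ?e * ((1 - (z' - z) * ?m) * integral {-1..1} ?w + (z' - z) * (?m * integral {-1..1} ?w))) {-1..1}"
    by (intro has_integral_add has_integral_mult_right I M1)
  then have "?e * ((1 - (z' - z) * ?m) * integral {-1..1} ?w + (z' - z) * (?m * integral {-1..1} ?w)) \<le>
     integral {-1..1} (bessel_weight k z')"
  proof (rule has_integral_le[OF _ I])
    fix s :: real
    have "?e * (1 + (z' - z) * (s - ?m)) \<le> ?e * exp ((z' - z) * (s - ?m))"
      by (intro mult_left_mono exp_ge_add_one_self) auto
    also have "\<dots> = exp ((z' - z) * s)"
      by (simp add: algebra_simps flip: exp_add)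
    finally have "?e * (1 + (z' - z) * (s - ?m)) * ?w s \<le> exp ((z' - z) * s) * ?w s"
      by (rule mult_right_mono) (rule bessel_weight_nonneg)
    moreover have "exp ((z' - z) * s) * ?w s = bessel_weight k z' s"
      by (simp add: bessel_weight_def algebra_simps flip: exp_add)
    ultimately show "?e * ((1 - (z' - z) * ?m) * ?w s + (z' - z) * (s * ?w s)) \<le> bessel_weight k z' s"
      by (simp add: algebra_simps)
  qed
  then have "integral {-1..1} ?w * ?e \<le> integral {-1..1} (bessel_weight k z')"
    by (simp add: algebra_simps)
  then have "Gamma (k + 1/2) / (sqrt pi * Gamma k) * (integral {-1..1} ?w * ?e) \<le>
      Gamma (k + 1/2) / (sqrt pi * Gamma k) * integral {-1..1} (bessel_weight k z')"
    using k by (intro mult_left_mono divide_nonneg_nonneg mult_nonneg_nonneg)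
       (auto intro!: less_imp_le[OF Gamma_real_pos])
  then show ?thesis
    unfolding bessel_J_eq_integral[OF k] by (simp only: mult.assoc mult_1_right)
qed

text \<open>
The weight of \<open>E\<^sub>k\<close> is \<open>1 + s\<close> times the weight of \<open>J\<^sub>k\<close>.
\<close>

lemma dunkl_E_eq:
  assumes k: "k > 1"
  shows "dunkl_E k x y = bessel_J k x y * (1 + bessel_mean k (x * y))"
proof -
  let ?w = "bessel_weight k (x * y)"
  have eq: "exp (x * y * s) * (1 - s) powr (k - 1) * (1 + s) powr k = (1 + s) * ?w s" if "s \<in> {-1..1}" for s
  proof -
    have "(1 - s\<^sup>2) powr (k - 1) = (1 - s) powr (k - 1) * (1 + s) powr (k - 1)"
      using that by (simp add: powr_mult[symmetric] algebra_simps power2_eq_square)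
    moreover have "(1 + s) powr k = (1 + s) * (1 + s) powr (k - 1)"
      using that powr_mult_base[of "1 + s" "k - 1"] by simp
    ultimately show ?thesis by (simp add: bessel_weight_def)
  qed
  have cont: "continuous_on {-1..1} (\<lambda>s. (1 + s) * ?w s)"
    by (intro continuous_on_mult continuous_on_bessel_weight k continuous_intros)
  then have "set_integrable lborel {-1..1} (\<lambda>s. (1 + s) * ?w s)"
    unfolding set_integrable_def by (intro borel_integrable_compact) auto
  note LINT = set_borel_integral_eq_integral(2)[OF this]
  have "(LINT s:{-1..1}|lborel. exp (x * y * s) * (1 - s) powr (k - 1) * (1 + s) powr k) =
      integral {-1..1} (\<lambda>s. (1 + s) * ?w s)"
    unfolding LINT[symmetric] by (intro set_lebesgue_integral_cong) (auto simp: eq)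
  also have "\<dots> = integral {-1..1} (\<lambda>s. ?w s + s * ?w s)"
    by (simp add: distrib_right)
  also have "\<dots> = integral {-1..1} ?w + integral {-1..1} (\<lambda>s. s * ?w s)"
    using bessel_weight_integrable[OF k, of "\<lambda>_. 1" "x * y"] bessel_weight_integrable[OF k continuous_on_id]
    by (intro integral_add) auto
  also have "\<dots> = integral {-1..1} ?w * (1 + bessel_mean k (x * y))"
    unfolding bessel_mean_eq[OF k] by (simp add: algebra_simps)
  finally show ?thesis
    unfolding dunkl_E_def bessel_J_eq_integral[OF k] by (simp add: Gamma_one_half_real)
qed

section \<open>Even integrands, Gaussian moments and Beta moments\<close>

lemma nn_integral_even_reflect:
  fixes f :: "real \<Rightarrow> ennreal"
  assumes f [measurable]: "f \<in> borel_measurable borel" and ev: "\<And>y. f (- y) = f y"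
  shows "(\<integral>\<^sup>+y. f y * indicator {..<0} y \<partial>lborel) = (\<integral>\<^sup>+y. f y * indicator {0<..} y \<partial>lborel)"
proof -
  have "(\<integral>\<^sup>+y. f y * indicator {..<0} y \<partial>lborel) =
      ennreal \<bar>-1\<bar> * (\<integral>\<^sup>+y. f (0 + (-1) * y) * indicator {..<0} (0 + (-1) * y) \<partial>lborel)"
    by (rule nn_integral_real_affine) simp_all
  moreover have "f (0 + (-1) * y) * indicator {..<0} (0 + (-1) * y) = f y * indicator {0<..} y" for y
    by (simp add: ev indicator_def)
  ultimately show ?thesis by simp
qed

lemma nn_integral_even:
  fixes f :: "real \<Rightarrow> ennreal"
  assumes f [measurable]: "f \<in> borel_measurable borel" and ev: "\<And>y. f (- y) = f y"
  shows "(\<integral>\<^sup>+y. f y \<partial>lborel) = 2 * (\<integral>\<^sup>+y. f y * indicator {0<..} y \<partial>lborel)"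
proof -
  have "AE y in lborel. y \<noteq> (0::real)" by (rule AE_lborel_singleton)
  then have "AE y in lborel. f y = f y * indicator {0<..} y + f y * indicator {..<0} y"
    by eventually_elim (auto simp: indicator_def)
  then have "(\<integral>\<^sup>+y. f y \<partial>lborel) = (\<integral>\<^sup>+y. f y * indicator {0<..} y + f y * indicator {..<0} y \<partial>lborel)"
    by (rule nn_integral_cong_AE)
  also have "\<dots> = (\<integral>\<^sup>+y. f y * indicator {0<..} y \<partial>lborel) + (\<integral>\<^sup>+y. f y * indicator {..<0} y \<partial>lborel)"
    by (rule nn_integral_add) measurable
  finally show ?thesis unfolding nn_integral_even_reflect[OF f ev] by (simp only: mult_2)
qed

lemma two_mult_ennreal: "2 * ennreal r = ennreal (2 * r)"
  by (simp add: ennreal_mult')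

text \<open>
Substitute \<open>u = A y\<^sup>2\<close> in Euler's integral on the positive half-line.
\<close>

lemma Gaussian_moment:
  fixes A q :: real
  assumes A: "A > 0" and q: "q > 0"
  shows "(\<integral>\<^sup>+y. ennreal (exp (- A * y\<^sup>2) * \<bar>y\<bar> powr (2 * q - 1)) \<partial>lborel) =
         ennreal (Gamma q * A powr - q)"
proof -
  let ?S = "{0::real<..}"
  let ?f = "\<lambda>u. u powr (q - 1) / exp u"
  have im: "(\<lambda>y. A * y\<^sup>2) ` ?S = ?S"
  proof (intro equalityI subsetI)
    fix u :: real assume "u \<in> ?S"
    then show "u \<in> (\<lambda>y. A * y\<^sup>2) ` ?S"
      using A by (intro image_eqI[where x="sqrt (u / A)"]) auto
  qed (use A in auto)
  have "(?f has_integral Gamma q) {0..}"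
    using q by (intro Gamma_integral_real) auto
  then have G: "(?f has_integral Gamma q) ?S"
    by (rule has_integral_spike_set_eq[THEN iffD1, rotated 2])
       (rule negligible_subset[of "{0}"], simp, force)+
  then have conj: "?f absolutely_integrable_on ?S \<and> integral ?S ?f = Gamma q"
    by (auto intro!: nonnegative_absolutely_integrable_1 integral_unique)
  have inj: "inj_on (\<lambda>y. A * y\<^sup>2) ?S"
    using A by (intro inj_onI) (simp add: power2_eq_iff_nonneg)
  have der: "((\<lambda>y. A * y\<^sup>2) has_field_derivative (2 * A * y)) (at y within ?S)" for y
    by (auto intro!: derivative_eq_intros)
  have "(\<lambda>y. \<bar>2 * A * y\<bar> * ?f (A * y\<^sup>2)) absolutely_integrable_on ?S \<and>
      integral ?S (\<lambda>y. \<bar>2 * A * y\<bar> * ?f (A * y\<^sup>2)) = Gamma q"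
    by (rule has_absolute_integral_change_of_variables_1'[OF _ der inj, unfolded im, THEN iffD2, OF _ conj]) simp
  then have "((\<lambda>y. \<bar>2 * A * y\<bar> * ?f (A * y\<^sup>2)) has_integral Gamma q) ?S"
    by (simp add: has_integral_iff set_lebesgue_integral_eq_integral(1))
  then have int: "((\<lambda>y. A powr - q / 2 * (\<bar>2 * A * y\<bar> * ?f (A * y\<^sup>2))) has_integral (A powr - q / 2 * Gamma q)) ?S"
    by (rule has_integral_mult_right)
  have eq: "A powr - q / 2 * (\<bar>2 * A * y\<bar> * ?f (A * y\<^sup>2)) = exp (- A * y\<^sup>2) * \<bar>y\<bar> powr (2 * q - 1)" if "y \<in> ?S" for y
  proof -
    have y: "y > 0" using that by simp
    have 1: "(A * y\<^sup>2) powr (q - 1) = A powr (q - 1) * y powr (2 * q - 2)"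
      using A y by (simp add: powr_mult powr_powr algebra_simps flip: powr_numeral)
    have 2: "A powr - q * A * A powr (q - 1) = 1"
      using A by (simp add: powr_diff powr_minus)
    have 3: "y * y powr (2 * q - 2) = y powr (2 * q - 1)"
      using y powr_mult_base[of y "2 * q - 2"] by simp
    have "A powr - q * (A * y) * (A * y\<^sup>2) powr (q - 1) =
        (A powr - q * A * A powr (q - 1)) * (y * y powr (2 * q - 2))"
      unfolding 1 by (simp only: mult_ac)
    then have 4: "A powr - q * (A * y) * (A * y\<^sup>2) powr (q - 1) = y powr (2 * q - 1)"
      unfolding 2 3 by simp
    have alg: "a / 2 * (2 * b * (c / d)) = (a * b * c) / d" for a b c d :: real
      by simp
    have abs_eq: "\<bar>2 * A * y\<bar> = 2 * (A * y)" using A y by simp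
    have "A powr - q / 2 * (\<bar>2 * A * y\<bar> * ?f (A * y\<^sup>2)) =
        (A powr - q * (A * y) * (A * y\<^sup>2) powr (q - 1)) / exp (A * y\<^sup>2)"
      unfolding abs_eq by (rule alg)
    also have "\<dots> = y powr (2 * q - 1) / exp (A * y\<^sup>2)"
      unfolding 4 ..
    also have "\<dots> = exp (- A * y\<^sup>2) * \<bar>y\<bar> powr (2 * q - 1)"
      using y by (simp add: exp_minus divide_inverse mult.commute)
    finally show ?thesis .
  qed
  have "((\<lambda>y. exp (- A * y\<^sup>2) * \<bar>y\<bar> powr (2 * q - 1)) has_integral (A powr - q / 2 * Gamma q)) ?S"
    using int by (simp only: eq cong: has_integral_cong)
  then have half: "(\<integral>\<^sup>+y. ennreal (exp (- A * y\<^sup>2) * \<bar>y\<bar> powr (2 * q - 1)) * indicator ?S y \<partial>lborel) =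
      ennreal (A powr - q / 2 * Gamma q)"
    by (intro nn_integral_has_integral_lebesgue') simp_all
  have "(\<integral>\<^sup>+y. ennreal (exp (- A * y\<^sup>2) * \<bar>y\<bar> powr (2 * q - 1)) \<partial>lborel) =
      2 * (\<integral>\<^sup>+y. ennreal (exp (- A * y\<^sup>2) * \<bar>y\<bar> powr (2 * q - 1)) * indicator ?S y \<partial>lborel)"
    by (rule nn_integral_even) simp_all
  also have "\<dots> = ennreal (Gamma q * A powr - q)"
    unfolding half two_mult_ennreal by (rule arg_cong[where f=ennreal]) simp
  finally show ?thesis .
qed

text \<open>
Substitute \<open>u = s\<^sup>2\<close> in Euler's Beta integral.
\<close>

lemma Beta_moment:
  fixes k :: real
  assumes k: "k > 0"
  shows "(\<integral>\<^sup>+s. ennreal (s ^ (2 * n) * (1 - s\<^sup>2) powr (k - 1)) * indicator {-1..1} s \<partial>lborel) =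
         ennreal (Beta (real n + 1/2) k)"
proof -
  let ?S = "{0::real<..<1}" and ?B = "Beta (real n + 1/2) k"
  let ?f = "\<lambda>u. u powr (real n + 1/2 - 1) * (1 - u) powr (k - 1)"
  let ?g = "\<lambda>s. s ^ (2 * n) * (1 - s\<^sup>2) powr (k - 1)"
  have im: "(\<lambda>s. s\<^sup>2) ` ?S = ?S"
  proof (intro equalityI subsetI)
    fix u :: real assume "u \<in> ?S"
    then show "u \<in> (\<lambda>y. y\<^sup>2) ` ?S"
      by (intro image_eqI[where x="sqrt u"]) auto
  qed (auto simp: power_less_one_iff abs_square_less_1)
  have "(?f has_integral ?B) {0..1}"
    using k by (intro has_integral_Beta_real) auto
  then have "(?f has_integral ?B) ?S" by (simp add: has_integral_Icc_iff_Ioo)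
  then have conj: "?f absolutely_integrable_on ?S \<and> integral ?S ?f = ?B"
    by (auto intro!: nonnegative_absolutely_integrable_1 integral_unique)
  have inj: "inj_on (\<lambda>s. s\<^sup>2) ?S"
    by (intro inj_onI) (simp add: power2_eq_iff_nonneg)
  have der: "((\<lambda>s. s\<^sup>2) has_field_derivative (2 * s)) (at s within ?S)" for s
    by (auto intro!: derivative_eq_intros)
  have "(\<lambda>s. \<bar>2 * s\<bar> * ?f (s\<^sup>2)) absolutely_integrable_on ?S \<and>
      integral ?S (\<lambda>s. \<bar>2 * s\<bar> * ?f (s\<^sup>2)) = ?B"
    by (rule has_absolute_integral_change_of_variables_1'[OF _ der inj, unfolded im, THEN iffD2, OF _ conj]) simp
  then have "((\<lambda>s. \<bar>2 * s\<bar> * ?f (s\<^sup>2)) has_integral ?B) ?S"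
    by (simp add: has_integral_iff set_lebesgue_integral_eq_integral(1))
  then have int: "((\<lambda>s. 1 / 2 * (\<bar>2 * s\<bar> * ?f (s\<^sup>2))) has_integral (1 / 2 * ?B)) ?S"
    by (rule has_integral_mult_right)
  have eq: "1 / 2 * (\<bar>2 * s\<bar> * ?f (s\<^sup>2)) = ?g s" if "s \<in> ?S" for s
  proof -
    have s: "s > 0" using that by simp
    have "(s\<^sup>2) powr (real n + 1/2 - 1) = s powr (2 * real n - 1)"
      using s by (simp add: powr_powr flip: powr_numeral)
    moreover have "s * s powr (2 * real n - 1) = s powr (real (2 * n))"
      using s powr_add[of s 1 "2 * real n - 1"] by simp
    moreover have "s powr (real (2 * n)) = s ^ (2 * n)"
      using s by (rule powr_realpow)
    ultimately show ?thesis using s by simp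
  qed
  have "(?g has_integral (1 / 2 * ?B)) ?S"
    using int by (simp only: eq cong: has_integral_cong)
  then have half: "(\<integral>\<^sup>+s. ennreal (?g s) * indicator ?S s \<partial>lborel) = ennreal (1 / 2 * ?B)"
    by (intro nn_integral_has_integral_lebesgue') simp_all
  \<comment> \<open>holds at \<open>s = 1\<close> as well, where \<open>0 powr (k - 1) = 0\<close> for every \<open>k\<close>\<close>
  have ind: "ennreal (?g s) * indicator {-1..1} s * indicator {0<..} s = ennreal (?g s) * indicator ?S s" for s
    by (cases "s = 1") (auto simp: indicator_def)
  have "(\<integral>\<^sup>+s. ennreal (?g s) * indicator {-1..1} s \<partial>lborel) =
      2 * (\<integral>\<^sup>+s. ennreal (?g s) * indicator {-1..1} s * indicator {0<..} s \<partial>lborel)"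
    by (rule nn_integral_even) (auto simp: indicator_def)
  also have "\<dots> = ennreal ?B"
    unfolding ind half two_mult_ennreal by simp
  finally show ?thesis .
qed

section \<open>Rearranging the double series of Weber's integral\<close>

lemma suminf_swap_ennreal:
  fixes f :: "nat \<Rightarrow> nat \<Rightarrow> ennreal"
  shows "(\<Sum>a. \<Sum>b. f a b) = (\<Sum>b. \<Sum>a. f a b)"
proof -
  have "(\<Sum>a. \<Sum>b. f a b) = (\<integral>\<^sup>+ a. (\<Sum>b. f a b) \<partial>count_space UNIV)"
    by (simp add: nn_integral_count_space_nat)
  also have "\<dots> = (\<Sum>b. \<integral>\<^sup>+ a. f a b \<partial>count_space UNIV)"
    by (rule nn_integral_suminf) simp
  finally show ?thesis by (simp add: nn_integral_count_space_nat)
qed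

lemma suminf_shift_ennreal:
  fixes g :: "nat \<Rightarrow> ennreal"
  shows "(\<Sum>a. if n \<le> a then g (a - n) else 0) = (\<Sum>a. g a)"
proof -
  let ?f = "\<lambda>a. if n \<le> a then g (a - n) else 0"
  have "(\<Sum>a. ?f a) = (\<Sum>a. ?f (a + n)) + (\<Sum>a<n. ?f a)"
    by (rule suminf_offset) simp
  also have "(\<Sum>a<n. ?f a) = 0" by simp
  finally show ?thesis by simp
qed

text \<open>
Vandermonde's convolution for \<open>\<kappa> + a - 1\<close> and \<open>b\<close>, divided by factorials and Gamma values to make it
symmetric in \<open>a\<close> and \<open>b\<close>.
\<close>

lemma Gamma_Vandermonde:
  fixes \<kappa> :: real
  assumes "\<kappa> > 0"
  shows "Gamma (real (a + b) + \<kappa>) / (fact a * fact b * Gamma (real a + \<kappa>) * Gamma (real b + \<kappa>)) =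
     (\<Sum>n\<le>a. if n \<le> b then 1 / (fact (a - n) * fact (b - n) * fact n * Gamma (real n + \<kappa>)) else 0)"
proof -
  have np: "x + 1 \<notin> \<int>\<^sub>\<le>\<^sub>0" if "x + 1 > 0" for x :: real
    using that nonpos_Ints_nonpos by force
  have G: "Gamma (real m + \<kappa>) > 0" for m
    using assms by (intro Gamma_real_pos) auto
  have 1: "((real a + \<kappa> - 1) + real b) gchoose a = Gamma (real (a + b) + \<kappa>) / (fact a * Gamma (real b + \<kappa>))"
    using assms by (subst gbinomial_Gamma[OF np]) (auto simp: algebra_simps)
  have 2: "(real a + \<kappa> - 1) gchoose (a - n) = Gamma (real a + \<kappa>) / (fact (a - n) * Gamma (real n + \<kappa>))"
    if "n \<le> a" for n
    using assms that by (subst gbinomial_Gamma[OF np]) (auto simp: algebra_simps of_nat_diff)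
  have "((real a + \<kappa> - 1) + real b) gchoose a =
      (\<Sum>n\<le>a. (real b gchoose n) * ((real a + \<kappa> - 1) gchoose (a - n)))"
    using gbinomial_Vandermonde[of "real b" "real a + \<kappa> - 1" a] by (simp add: add.commute atLeast0AtMost)
  also have "\<dots> = (\<Sum>n\<le>a. (fact b * Gamma (real a + \<kappa>)) *
      (if n \<le> b then 1 / (fact (a - n) * fact (b - n) * fact n * Gamma (real n + \<kappa>)) else 0))"
    by (intro sum.cong refl)
       (auto simp: 2 binomial_gbinomial[symmetric] binomial_fact binomial_eq_0)
  finally have "Gamma (real (a + b) + \<kappa>) / (fact a * Gamma (real b + \<kappa>)) = (fact b * Gamma (real a + \<kappa>)) *
      (\<Sum>n\<le>a. if n \<le> b then 1 / (fact (a - n) * fact (b - n) * fact n * Gamma (real n + \<kappa>)) else 0)"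
    unfolding 1 by (simp add: sum_distrib_left)
  then show ?thesis
    using G[of a] G[of b] by (simp add: divide_simps mult_ac)
qed

lemma ennreal_exp_series:
  assumes "(x::real) \<ge> 0"
  shows "(\<Sum>n. ennreal (x ^ n / fact n)) = ennreal (exp x)"
  using assms exp_converges[of x]
  by (intro suminf_ennreal_eq) (auto simp: divide_inverse mult.commute scaleR_conv_of_real)

text \<open>
For \<open>\<kappa> = k + 1/2\<close> the coefficient of \<open>z\<^sup>2\<^sup>n\<close> in the power series of the Bessel function.
\<close>

definition bessel_coeff :: "real \<Rightarrow> nat \<Rightarrow> real" where
  "bessel_coeff \<kappa> n = Gamma \<kappa> / (4 ^ n * fact n * Gamma (real n + \<kappa>))"

lemma bessel_coeff_pos: "\<kappa> > 0 \<Longrightarrow> bessel_coeff \<kappa> n > 0"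
  unfolding bessel_coeff_def by (intro divide_pos_pos mult_pos_pos Gamma_real_pos) auto

text \<open>
Expand each coefficient by \<open>Gamma_Vandermonde\<close> and sum over \<open>n\<close> last: for fixed \<open>n\<close> the sums over
\<open>a \<ge> n\<close> and \<open>b \<ge> n\<close> are shifted exponential series. The terms are nonnegative, so in \<open>ennreal\<close> the
order of summation is free.
\<close>

lemma weber_double_series:
  fixes \<kappa> X W :: real
  assumes \<kappa>: "\<kappa> > 0" and X: "X \<ge> 0" and W: "W \<ge> 0"
  shows "(\<Sum>a. \<Sum>b. ennreal (X ^ a * W ^ b * (Gamma (real (a + b) + \<kappa>) /
            (fact a * fact b * Gamma (real a + \<kappa>) * Gamma (real b + \<kappa>))))) =
         ennreal (exp (X + W)) * (\<Sum>n. ennreal ((X * W) ^ n / (fact n * Gamma (real n + \<kappa>))))"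
    (is "?lhs = ?rhs")
proof -
  have G: "Gamma (real m + \<kappa>) > 0" for m
    using \<kappa> by (intro Gamma_real_pos) auto
  let ?c = "\<lambda>n. (X * W) ^ n / (fact n * Gamma (real n + \<kappa>))"
  let ?f = "\<lambda>n a b. ennreal (?c n) * ((if n \<le> a then ennreal (X ^ (a - n) / fact (a - n)) else 0) *
       (if n \<le> b then ennreal (W ^ (b - n) / fact (b - n)) else 0))"
  have c: "?c n \<ge> 0" for n using X W G[of n] by simp
  have nonneg: "?c n * (X ^ (a - n) / fact (a - n) * (W ^ (b - n) / fact (b - n))) \<ge> 0" for n a b
    by (intro mult_nonneg_nonneg divide_nonneg_nonneg zero_le_power X W c) simp_all
  have summand: "ennreal (X ^ a * W ^ b * (Gamma (real (a + b) + \<kappa>) /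
            (fact a * fact b * Gamma (real a + \<kappa>) * Gamma (real b + \<kappa>)))) = (\<Sum>n. ?f n a b)" for a b
  proof -
    have split: "X ^ a * W ^ b * (Gamma (real (a + b) + \<kappa>) /
            (fact a * fact b * Gamma (real a + \<kappa>) * Gamma (real b + \<kappa>))) =
       (\<Sum>n\<le>a. if n \<le> b then ?c n * (X ^ (a - n) / fact (a - n) * (W ^ (b - n) / fact (b - n))) else 0)"
      unfolding Gamma_Vandermonde[OF \<kappa>] sum_distrib_left
    proof (intro sum.cong refl)
      fix n assume "n \<in> {..a}"
      then have Xa: "X ^ a = X ^ n * X ^ (a - n)" by (simp flip: power_add)
      have alg: "xn * x * (wn * w) * (1 / (f * g * h * G)) = (xn * wn) / (h * G) * (x / f * (w / g))"
        for xn x wn w f g h G :: real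
        by (simp only: divide_inverse inverse_mult_distrib mult_1_left mult_ac)
      show "X ^ a * W ^ b * (if n \<le> b then 1 / (fact (a - n) * fact (b - n) * fact n * Gamma (real n + \<kappa>)) else 0)
         = (if n \<le> b then ?c n * (X ^ (a - n) / fact (a - n) * (W ^ (b - n) / fact (b - n))) else 0)"
      proof (cases "n \<le> b")
        case True
        then have Wb: "W ^ b = W ^ n * W ^ (b - n)" by (simp flip: power_add)
        show ?thesis
          unfolding Xa Wb power_mult_distrib if_P[OF True] by (rule alg)
      qed simp
    qed
    have "ennreal (X ^ a * W ^ b * (Gamma (real (a + b) + \<kappa>) /
            (fact a * fact b * Gamma (real a + \<kappa>) * Gamma (real b + \<kappa>)))) =
        ennreal (\<Sum>n\<le>a. if n \<le> b then ?c n * (X ^ (a - n) / fact (a - n) * (W ^ (b - n) / fact (b - n))) else 0)"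
      by (rule arg_cong[OF split])
    also have "\<dots> = (\<Sum>n\<le>a. ennreal (if n \<le> b then ?c n * (X ^ (a - n) / fact (a - n) * (W ^ (b - n) / fact (b - n))) else 0))"
    proof (rule sum_ennreal[symmetric])
      fix n
      show "0 \<le> (if n \<le> b then ?c n * (X ^ (a - n) / fact (a - n) * (W ^ (b - n) / fact (b - n))) else 0)"
        by (cases "n \<le> b") (simp_all only: if_True if_False nonneg order_refl)
    qed
    also have "\<dots> = (\<Sum>n\<le>a. ?f n a b)"
    proof (rule sum.cong[OF refl])
      fix n assume "n \<in> {..a}"
      then have n: "n \<le> a" by simp
      have emult: "ennreal (u * (x * w)) = ennreal u * (ennreal x * ennreal w)"
        if "u \<ge> 0" "x \<ge> 0" "w \<ge> 0" for u x w :: real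
        using that by (metis ennreal_mult mult_nonneg_nonneg)
      have X': "X ^ (a - n) / fact (a - n) \<ge> 0" and W': "W ^ (b - n) / fact (b - n) \<ge> 0"
        using X W by simp_all
      show "ennreal (if n \<le> b then ?c n * (X ^ (a - n) / fact (a - n) * (W ^ (b - n) / fact (b - n))) else 0)
          = ?f n a b"
      proof (cases "n \<le> b")
        case True
        show ?thesis
          unfolding if_P[OF True] if_P[OF n] by (rule emult[OF c X' W'])
      qed simp
    qed
    also have "\<dots> = (\<Sum>n. ?f n a b)"
      by (intro suminf_finite[symmetric]) auto
    finally show ?thesis .
  qed
  have "?lhs = (\<Sum>a. \<Sum>b. \<Sum>n. ?f n a b)" unfolding summand ..
  also have "\<dots> = (\<Sum>a. \<Sum>n. \<Sum>b. ?f n a b)" by (subst suminf_swap_ennreal) simp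
  also have "\<dots> = (\<Sum>n. \<Sum>a. \<Sum>b. ?f n a b)" by (rule suminf_swap_ennreal)
  also have "\<dots> = (\<Sum>n. ennreal (?c n) * (ennreal (exp X) * ennreal (exp W)))"
    unfolding ennreal_suminf_cmult ennreal_suminf_multc suminf_shift_ennreal[of _ "\<lambda>m. ennreal (X ^ m / fact m)"]
      suminf_shift_ennreal[of _ "\<lambda>m. ennreal (W ^ m / fact m)"] ennreal_exp_series[OF X] ennreal_exp_series[OF W] ..
  also have "\<dots> = ?rhs"
    by (simp add: ennreal_suminf_multc exp_add ennreal_mult mult.commute)
  finally show ?thesis .
qed

section \<open>Power series of the Bessel function and Weber's integral\<close>

lemma Gamma_half_nat: "Gamma (real n + 1/2) * 4 ^ n * fact n = sqrt pi * fact (2 * n)"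
proof (induction n)
  case 0
  then show ?case by (simp add: Gamma_one_half_real)
next
  case (Suc n)
  have "real n + 1/2 \<notin> \<int>\<^sub>\<le>\<^sub>0"
    using nonpos_Ints_nonpos[of "real n + 1/2"] by linarith
  then have "Gamma (real (Suc n) + 1/2) = (real n + 1/2) * Gamma (real n + 1/2)"
    using Gamma_plus1[of "real n + 1/2"] by (simp add: add_ac)
  then have "Gamma (real (Suc n) + 1/2) * 4 ^ Suc n * fact (Suc n) =
      (2 * real n + 1) * (2 * (real n + 1)) * (Gamma (real n + 1/2) * 4 ^ n * fact n)"
    by (simp add: algebra_simps)
  also have "\<dots> = sqrt pi * fact (2 * Suc n)"
    unfolding Suc by (simp add: algebra_simps)
  finally show ?case .
qed

lemma cosh_even_series: "(\<lambda>n. x ^ (2 * n) / fact (2 * n)) sums cosh (x::real)"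
proof -
  have mono: "strict_mono ((*) (2::nat))" by (auto simp: strict_mono_def)
  have "(\<lambda>n. if even (2 * n) then x ^ (2 * n) /\<^sub>R fact (2 * n) else 0) sums cosh x"
    using cosh_converges[of x]
    by (subst sums_mono_reindex[OF mono, of "\<lambda>n. if even n then x ^ n /\<^sub>R fact n else 0"]) auto
  then show ?thesis by (simp add: divide_inverse mult.commute)
qed

text \<open>
Averaging over \<open>s\<close> and \<open>-s\<close> replaces \<open>exp (z s)\<close> by \<open>cosh (z s)\<close>, whose Taylor series has nonnegative
terms for every real \<open>z\<close>; it can then be integrated term by term.
\<close>

lemma nn_integral_bessel_weight:
  assumes "k > 0"
  shows "(\<integral>\<^sup>+s. ennreal (bessel_weight k z s) * indicator {-1..1} s \<partial>lborel) =
    (\<Sum>n. ennreal (z ^ (2 * n) / fact (2 * n) * Beta (real n + 1/2) k))"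
proof -
  let ?w = "\<lambda>s. ennreal (bessel_weight k z s) * indicator {-1..1} s"
  let ?m = "\<lambda>n s. ennreal (s ^ (2 * n) * (1 - s\<^sup>2) powr (k - 1)) * indicator {-1..1} s"
  let ?z = "\<lambda>n. z ^ (2 * n) / fact (2 * n)"
  have w[measurable]: "?w \<in> borel_measurable borel"
    unfolding bessel_weight_def by measurable
  have "(\<integral>\<^sup>+s. ?w s \<partial>lborel) = ennreal \<bar>-1\<bar> * (\<integral>\<^sup>+s. ?w (0 + (-1) * s) \<partial>lborel)"
    by (rule nn_integral_real_affine[OF w]) simp
  then have refl_w: "(\<integral>\<^sup>+s. ?w s \<partial>lborel) = (\<integral>\<^sup>+s. ?w (- s) \<partial>lborel)"
    by simp
  have sum_w: "?w s + ?w (- s) = (\<Sum>n. ennreal (2 * ?z n) * ?m n s)" for s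
  proof -
    have "(\<lambda>n. (2 * (1 - s\<^sup>2) powr (k - 1)) * ((z * s) ^ (2 * n) / fact (2 * n))) sums
         ((2 * (1 - s\<^sup>2) powr (k - 1)) * cosh (z * s))"
      by (intro sums_mult cosh_even_series)
    moreover have "(2 * (1 - s\<^sup>2) powr (k - 1)) * ((z * s) ^ (2 * n) / fact (2 * n)) =
        (2 * ?z n) * (s ^ (2 * n) * (1 - s\<^sup>2) powr (k - 1))" for n
      by (simp add: power_mult_distrib)
    moreover have "(2 * (1 - s\<^sup>2) powr (k - 1)) * cosh (z * s) = bessel_weight k z s + bessel_weight k z (- s)"
      by (simp add: bessel_weight_def cosh_def algebra_simps)
    ultimately have "(\<lambda>n. (2 * ?z n) * (s ^ (2 * n) * (1 - s\<^sup>2) powr (k - 1))) sums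
        (bessel_weight k z s + bessel_weight k z (- s))"
      by (simp only:)
    then have "(\<Sum>n. ennreal ((2 * ?z n) * (s ^ (2 * n) * (1 - s\<^sup>2) powr (k - 1)))) =
        ennreal (bessel_weight k z s + bessel_weight k z (- s))"
      by (intro suminf_ennreal_eq) simp_all
    moreover have "ennreal ((2 * ?z n) * (s ^ (2 * n) * (1 - s\<^sup>2) powr (k - 1))) =
        ennreal (2 * ?z n) * ennreal (s ^ (2 * n) * (1 - s\<^sup>2) powr (k - 1))" for n
      by (rule ennreal_mult) simp_all
    ultimately have "(\<Sum>n. ennreal (2 * ?z n) * ennreal (s ^ (2 * n) * (1 - s\<^sup>2) powr (k - 1))) =
        ennreal (bessel_weight k z s + bessel_weight k z (- s))"
      by (simp only:)
    moreover have "?w s + ?w (- s) = ennreal (bessel_weight k z s + bessel_weight k z (- s)) * indicator {-1..1} s"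
      by (auto simp: indicator_def ennreal_plus[OF bessel_weight_nonneg bessel_weight_nonneg])
    moreover have "(\<Sum>n. ennreal (2 * ?z n) * ?m n s) =
        (\<Sum>n. ennreal (2 * ?z n) * ennreal (s ^ (2 * n) * (1 - s\<^sup>2) powr (k - 1))) * indicator {-1..1} s"
      unfolding ennreal_suminf_multc[symmetric] mult.assoc ..
    ultimately show ?thesis by (simp only:)
  qed
  have Beta_nonneg: "Beta (real n + 1/2) k \<ge> 0" for n
    unfolding Beta_def using assms
    by (intro divide_nonneg_nonneg mult_nonneg_nonneg) (auto intro!: less_imp_le[OF Gamma_real_pos])
  have "2 * (\<integral>\<^sup>+s. ?w s \<partial>lborel) = (\<integral>\<^sup>+s. ?w s \<partial>lborel) + (\<integral>\<^sup>+s. ?w (- s) \<partial>lborel)"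
    unfolding refl_w[symmetric] by (rule mult_2)
  also have "\<dots> = (\<integral>\<^sup>+s. ?w s + ?w (- s) \<partial>lborel)"
    by (rule nn_integral_add[symmetric]) simp_all
  also have "\<dots> = (\<integral>\<^sup>+s. (\<Sum>n. ennreal (2 * ?z n) * ?m n s) \<partial>lborel)"
    unfolding sum_w ..
  also have "\<dots> = (\<Sum>n. (\<integral>\<^sup>+s. ennreal (2 * ?z n) * ?m n s \<partial>lborel))"
    by (rule nn_integral_suminf) simp
  also have "\<dots> = (\<Sum>n. ennreal (2 * ?z n) * ennreal (Beta (real n + 1/2) k))"
    by (subst nn_integral_cmult) (simp_all add: Beta_moment[OF assms])
  also have "\<dots> = (\<Sum>n. 2 * ennreal (?z n * Beta (real n + 1/2) k))"
  proof (rule suminf_cong)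
    fix n
    have "ennreal (2 * ?z n) * ennreal (Beta (real n + 1/2) k) = ennreal ((2 * ?z n) * Beta (real n + 1/2) k)"
      by (rule ennreal_mult[symmetric]) (simp_all add: Beta_nonneg)
    then show "ennreal (2 * ?z n) * ennreal (Beta (real n + 1/2) k) = 2 * ennreal (?z n * Beta (real n + 1/2) k)"
      unfolding two_mult_ennreal by (simp only: mult.assoc)
  qed
  also have "\<dots> = 2 * (\<Sum>n. ennreal (?z n * Beta (real n + 1/2) k))"
    by (rule ennreal_suminf_cmult)
  finally show ?thesis
    unfolding ennreal_mult_cancel_left by simp
qed

lemma bessel_J_series:
  assumes k: "k > 1"
  shows "ennreal (bessel_J k z 1) = (\<Sum>n. ennreal (bessel_coeff (k + 1/2) n * z ^ (2 * n)))"
proof -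
  let ?c = "Gamma (k + 1/2) / (sqrt pi * Gamma k)"
  have G: "Gamma (k + 1/2) > 0" "Gamma k > 0" using k by (auto intro!: Gamma_real_pos)
  then have c: "?c \<ge> 0" by simp
  have "((\<lambda>s. bessel_weight k z s) has_integral integral {-1..1} (bessel_weight k z)) {-1..1}"
    using bessel_weight_integrable[OF k, of "\<lambda>_. 1" z] by (simp add: integrable_integral)
  then have int: "ennreal (integral {-1..1} (bessel_weight k z)) =
     (\<integral>\<^sup>+s. ennreal (bessel_weight k z s) * indicator {-1..1} s \<partial>lborel)"
    by (intro nn_integral_has_integral_lebesgue'[symmetric] bessel_weight_nonneg)
  have "ennreal (bessel_J k z 1) = ennreal (?c * integral {-1..1} (bessel_weight k z))"
    unfolding bessel_J_eq_integral[OF k] by (simp only: mult_1_right)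
  also have "\<dots> = ennreal ?c * (\<Sum>n. ennreal (z ^ (2 * n) / fact (2 * n) * Beta (real n + 1/2) k))"
    using k by (subst nn_integral_bessel_weight[symmetric], simp, fold int, intro ennreal_mult'[OF c])
  also have "\<dots> = (\<Sum>n. ennreal ?c * ennreal (z ^ (2 * n) / fact (2 * n) * Beta (real n + 1/2) k))"
    by (rule ennreal_suminf_cmult[symmetric])
  also have "\<dots> = (\<Sum>n. ennreal (bessel_coeff (k + 1/2) n * z ^ (2 * n)))"
  proof (rule suminf_cong)
    fix n
    have "Gamma (real n + 1/2) = sqrt pi * fact (2 * n) / (4 ^ n * fact n)"
      using Gamma_half_nat[of n] by (simp add: field_simps)
    then have "?c * (z ^ (2 * n) / fact (2 * n) * Beta (real n + 1/2) k) = bessel_coeff (k + 1/2) n * z ^ (2 * n)"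
      using G by (simp add: Beta_def bessel_coeff_def add_ac)
    then show "ennreal ?c * ennreal (z ^ (2 * n) / fact (2 * n) * Beta (real n + 1/2) k) =
        ennreal (bessel_coeff (k + 1/2) n * z ^ (2 * n))"
      by (simp only: ennreal_mult'[OF c, symmetric])
  qed
  finally show ?thesis .
qed

text \<open>
Multiply the power series of the two Bessel functions and integrate term by term by
\<open>Gaussian_moment\<close>. All terms are nonnegative, since only even powers occur. In the variables
\<open>X = B\<^sup>2 / (4A)\<close> and \<open>W = w\<^sup>2 / (4A)\<close> the result is the double series of \<open>weber_double_series\<close>.
\<close>

lemma weber_second_exponential_integral:
  assumes k: "k > 1" and A: "A > 0"
  shows "(\<integral>\<^sup>+y. ennreal (exp (- A * y\<^sup>2) * (bessel_J k (B * y) 1 * bessel_J k (w * y) 1) * \<bar>y\<bar> powr (2 * k)) \<partial>lborel) =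
         ennreal (Gamma (k + 1/2) * A powr - (k + 1/2) * exp ((B\<^sup>2 + w\<^sup>2) / (4 * A)) * bessel_J k (B * w / (2 * A)) 1)"
proof -
  define \<kappa> where "\<kappa> = k + 1/2"
  have \<kappa>: "\<kappa> > 0" using k by (simp add: \<kappa>_def)
  define X W where "X = B\<^sup>2 / (4 * A)" and "W = w\<^sup>2 / (4 * A)"
  have XW: "X \<ge> 0" "W \<ge> 0" using A by (auto simp: X_def W_def)
  let ?c = "bessel_coeff \<kappa>"
  have c: "?c n \<ge> 0" for n using bessel_coeff_pos[OF \<kappa>, of n] by simp
  let ?K = "\<lambda>a b. ?c a * ?c b * B ^ (2 * a) * w ^ (2 * b)"
  have K: "?K a b \<ge> 0" for a b
    by (intro mult_nonneg_nonneg c) simp_all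
  let ?g = "\<lambda>a b y. ennreal (exp (- A * y\<^sup>2) * \<bar>y\<bar> powr (2 * (real (a + b) + \<kappa>) - 1))"
  have expand: "ennreal (exp (- A * y\<^sup>2) * (bessel_J k (B * y) 1 * bessel_J k (w * y) 1) * \<bar>y\<bar> powr (2 * k)) =
      (\<Sum>a. \<Sum>b. ennreal (?K a b) * ?g a b y)" for y
  proof -
    let ?e = "exp (- A * y\<^sup>2) * \<bar>y\<bar> powr (2 * k)"
    have e: "?e \<ge> 0" by simp
    have term_eq: "ennreal ?e * (ennreal (?c a * (B * y) ^ (2 * a)) * ennreal (?c b * (w * y) ^ (2 * b))) =
       ennreal (?K a b) * ?g a b y" for a b
    proof -
      \<comment> \<open>at \<open>y = 0\<close> both sides are 0, since \<open>0 powr c = 0\<close> for every \<open>c\<close>\<close>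
      have pw: "\<bar>y\<bar> powr (2 * k) * y ^ (2 * a) * y ^ (2 * b) = \<bar>y\<bar> powr (2 * (real (a + b) + \<kappa>) - 1)"
      proof (cases "y = 0")
        case False
        have "2 * (real (a + b) + \<kappa>) - 1 = 2 * k + real (2 * a + 2 * b)"
          by (simp add: \<kappa>_def)
        then have "\<bar>y\<bar> powr (2 * (real (a + b) + \<kappa>) - 1) = \<bar>y\<bar> powr (2 * k) * \<bar>y\<bar> ^ (2 * a + 2 * b)"
          using False by (simp only: powr_add powr_realpow zero_less_abs_iff not_False_eq_True)
        also have "\<bar>y\<bar> ^ (2 * a + 2 * b) = y ^ (2 * a) * y ^ (2 * b)"
          by (simp add: power_add power_even_abs)
        finally show ?thesis by simp
      qed (use k in simp)
      have eq: "?e * ((?c a * (B * y) ^ (2 * a)) * (?c b * (w * y) ^ (2 * b))) =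
          ?K a b * (exp (- A * y\<^sup>2) * \<bar>y\<bar> powr (2 * (real (a + b) + \<kappa>) - 1))"
        unfolding pw[symmetric] power_mult_distrib by (simp only: mult_ac)
      have p: "?c a * (B * y) ^ (2 * a) \<ge> 0"
        by (intro mult_nonneg_nonneg c) simp
      have "ennreal ?e * (ennreal (?c a * (B * y) ^ (2 * a)) * ennreal (?c b * (w * y) ^ (2 * b))) =
          ennreal (?e * ((?c a * (B * y) ^ (2 * a)) * (?c b * (w * y) ^ (2 * b))))"
        unfolding ennreal_mult'[OF e] ennreal_mult'[OF p] ..
      then show ?thesis
        unfolding eq ennreal_mult'[OF K] .
    qed
    have "ennreal (exp (- A * y\<^sup>2) * (bessel_J k (B * y) 1 * bessel_J k (w * y) 1) * \<bar>y\<bar> powr (2 * k)) =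
        ennreal (?e * (bessel_J k (B * y) 1 * bessel_J k (w * y) 1))"
      by (simp only: mult_ac)
    also have "\<dots> = ennreal ?e * (ennreal (bessel_J k (B * y) 1) * ennreal (bessel_J k (w * y) 1))"
      unfolding ennreal_mult'[OF e] ennreal_mult'[OF less_imp_le[OF bessel_J_pos[OF k]]] ..
    also have "\<dots> = (\<Sum>a. \<Sum>b. ennreal ?e * (ennreal (?c a * (B * y) ^ (2 * a)) * ennreal (?c b * (w * y) ^ (2 * b))))"
      unfolding bessel_J_series[OF k] \<kappa>_def[symmetric] ennreal_suminf_cmult ennreal_suminf_multc ..
    finally show ?thesis unfolding term_eq .
  qed
  have moment: "(\<integral>\<^sup>+y. ?g a b y \<partial>lborel) = ennreal (Gamma (real (a + b) + \<kappa>) * A powr - (real (a + b) + \<kappa>))" for a b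
    using \<kappa> by (intro Gaussian_moment A) simp
  have meas: "?g a b \<in> borel_measurable lborel" for a b by simp
  have G: "Gamma (real m + \<kappa>) > 0" for m
    using \<kappa> by (intro Gamma_real_pos) auto
  let ?M = "(Gamma \<kappa>)\<^sup>2 * A powr - \<kappa>"
  have M: "?M \<ge> 0" by simp
  let ?T = "\<lambda>a b. X ^ a * W ^ b * (Gamma (real (a + b) + \<kappa>) /
            (fact a * fact b * Gamma (real a + \<kappa>) * Gamma (real b + \<kappa>)))"
  have coeff: "ennreal (?K a b) * ennreal (Gamma (real (a + b) + \<kappa>) * A powr - (real (a + b) + \<kappa>)) =
      ennreal ?M * ennreal (?T a b)" for a b
  proof -
    have "A powr - (real (a + b) + \<kappa>) = A powr - \<kappa> / (A ^ a * A ^ b)"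
      by (simp only: powr_minus powr_add powr_realpow[OF A] power_add divide_inverse inverse_mult_distrib mult_ac)
    moreover have "X ^ a = B ^ (2 * a) / (4 ^ a * A ^ a)" "W ^ b = w ^ (2 * b) / (4 ^ b * A ^ b)"
      by (simp_all only: X_def W_def power_divide power_mult power_mult_distrib)
    moreover have "(g / (fa * ea * Ga)) * (g / (fb * eb * Gb)) * Bx * Wx * (Gab * (P / (Aa * Ab))) =
        g\<^sup>2 * P * (Bx / (fa * Aa) * (Wx / (fb * Ab)) * (Gab / (ea * eb * Ga * Gb)))"
      for g fa ea Ga fb eb Gb Bx Wx Gab P Aa Ab :: real
      by (simp only: divide_inverse inverse_mult_distrib power2_eq_square mult_ac)
    ultimately have "?K a b * (Gamma (real (a + b) + \<kappa>) * A powr - (real (a + b) + \<kappa>)) = ?M * ?T a b"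
      by (simp only: bessel_coeff_def)
    then show ?thesis by (simp only: ennreal_mult'[OF K, symmetric] ennreal_mult'[OF M, symmetric])
  qed
  have "(\<integral>\<^sup>+y. (\<Sum>a. \<Sum>b. ennreal (?K a b) * ?g a b y) \<partial>lborel) =
      (\<Sum>a. \<integral>\<^sup>+y. (\<Sum>b. ennreal (?K a b) * ?g a b y) \<partial>lborel)"
    by (rule nn_integral_suminf) simp
  also have "\<dots> = (\<Sum>a. \<Sum>b. \<integral>\<^sup>+y. ennreal (?K a b) * ?g a b y \<partial>lborel)"
    by (subst nn_integral_suminf) simp_all
  also have "\<dots> = (\<Sum>a. \<Sum>b. ennreal ?M * ennreal (?T a b))"
    unfolding nn_integral_cmult[OF meas] moment coeff ..
  also have "\<dots> = ennreal ?M * (\<Sum>a. \<Sum>b. ennreal (?T a b))"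
    unfolding ennreal_suminf_cmult ..
  also have "\<dots> = ennreal ?M * (ennreal (exp (X + W)) * (\<Sum>n. ennreal ((X * W) ^ n / (fact n * Gamma (real n + \<kappa>)))))"
    unfolding weber_double_series[OF \<kappa> XW] ..
  also have "\<dots> = ennreal (Gamma \<kappa> * A powr - \<kappa> * exp (X + W)) * (\<Sum>n. ennreal (?c n * (B * w / (2 * A)) ^ (2 * n)))"
  proof -
    have s: "ennreal (Gamma \<kappa>) * ennreal ((X * W) ^ n / (fact n * Gamma (real n + \<kappa>))) = ennreal (?c n * (B * w / (2 * A)) ^ (2 * n))" for n
    proof -
      have "(X * W) = (B * w / (2 * A))\<^sup>2 / 4"
        by (simp add: X_def W_def power_mult_distrib power_divide power2_eq_square)
      then have "(X * W) ^ n = (B * w / (2 * A)) ^ (2 * n) / 4 ^ n"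
        by (simp only: power_divide power_mult)
      then have "Gamma \<kappa> * ((X * W) ^ n / (fact n * Gamma (real n + \<kappa>))) = ?c n * (B * w / (2 * A)) ^ (2 * n)"
        by (simp add: bessel_coeff_def)
      moreover have "Gamma \<kappa> \<ge> 0" using G[of 0] by simp
      ultimately show ?thesis by (simp only: ennreal_mult'[symmetric])
    qed
    have "ennreal ?M * ennreal (exp (X + W)) = ennreal (Gamma \<kappa> * A powr - \<kappa> * exp (X + W)) * ennreal (Gamma \<kappa>)"
      by (subst ennreal_mult'[symmetric], simp, subst ennreal_mult''[symmetric])
         (use G[of 0] in \<open>simp_all add: power2_eq_square mult_ac\<close>)
    then show ?thesis
      unfolding s[symmetric] ennreal_suminf_cmult by (simp only: mult.assoc[symmetric])
  qed
  also have "\<dots> = ennreal (Gamma \<kappa> * A powr - \<kappa> * exp (X + W)) * ennreal (bessel_J k (B * w / (2 * A)) 1)"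
    unfolding bessel_J_series[OF k] \<kappa>_def ..
  also have "\<dots> = ennreal (Gamma \<kappa> * A powr - \<kappa> * exp (X + W) * bessel_J k (B * w / (2 * A)) 1)"
    by (rule ennreal_mult''[symmetric]) (rule less_imp_le[OF bessel_J_pos[OF k]])
  finally show ?thesis
    unfolding expand by (simp add: X_def W_def \<kappa>_def add_divide_distrib)
qed

section \<open>The symmetric kernel and its concentration\<close>

text \<open>
The density of the Dunkl kernel with every \<open>E\<^sub>k\<close> replaced by \<open>J\<^sub>k\<close>. It is the symmetric reference
density of which both kernels are multiples.
\<close>

definition bessel_density :: "real \<Rightarrow> real \<Rightarrow> real \<Rightarrow> real \<Rightarrow> real \<Rightarrow> real" where
  "bessel_density k w t x y =
     exp (- (w\<^sup>2 * t / 2)) / ((2 * t) powr (k + 1/2) * Gamma (k + 1/2)) *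
     (exp (- ((x\<^sup>2 + y\<^sup>2) / (2 * t))) *
      (bessel_J k (x / sqrt t) (y / sqrt t) * bessel_J k y w / bessel_J k x w) *
      \<bar>y\<bar> powr (2 * k))"

lemma borel_measurable_bessel_J [measurable]: "(\<lambda>y. bessel_J k (f y) c) \<in> borel_measurable M"
  if [measurable]: "f \<in> borel_measurable M"
  unfolding bessel_J_def set_lebesgue_integral_def by measurable

lemma bessel_J_commute: "bessel_J k x y = bessel_J k y x"
  by (simp add: bessel_J_def mult.commute)

text \<open>
Only even powers occur in the power series.
\<close>

lemma bessel_J_minus: 
  assumes "k > 1"
  shows "bessel_J k (- x) y = bessel_J k x y"
proof -
  have "ennreal (bessel_J k (- x * y) 1) = ennreal (bessel_J k (x * y) 1)"
    unfolding bessel_J_series[OF assms] by simp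
  then have "bessel_J k (- x * y) 1 = bessel_J k (x * y) 1"
    using bessel_J_pos[OF assms] by (simp add: less_imp_le)
  then show ?thesis using bessel_J_mult[of k "-x" y] bessel_J_mult[of k x y] by simp
qed

lemma borel_measurable_bessel_density [measurable]: "bessel_density k w t x \<in> borel_measurable borel"
proof -
  have "bessel_density k w t x = (\<lambda>y. exp (- (w\<^sup>2 * t / 2)) / ((2 * t) powr (k + 1/2) * Gamma (k + 1/2)) *
     (exp (- ((x\<^sup>2 + y\<^sup>2) / (2 * t))) *
      (bessel_J k (y / sqrt t) (x / sqrt t) * bessel_J k y w / bessel_J k x w) *
      \<bar>y\<bar> powr (2 * k)))"
    by (intro ext) (simp only: bessel_density_def bessel_J_commute[of k "x / sqrt t"])
  then show ?thesis by simp
qed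

lemma bessel_density_nonneg:
  assumes "k > 1" "t > 0"
  shows "bessel_density k w t x y \<ge> 0"
  unfolding bessel_density_def using assms
  by (intro mult_nonneg_nonneg divide_nonneg_nonneg less_imp_le[OF bessel_J_pos]) (auto intro!: less_imp_le[OF Gamma_real_pos])

lemma bessel_density_minus:
  assumes "k > 1"
  shows "bessel_density k w t x (- y) = bessel_density k w t x y"
  unfolding bessel_density_def bessel_J_commute[of k "x / sqrt t"]
  by (simp add: bessel_J_minus[OF assms])

text \<open>
The factor \<open>exp (c y\<^sup>2)\<close> only changes the Gaussian parameter in Weber's integral, from \<open>1 / (2t)\<close> to
\<open>1 / (2t\<sigma>)\<close>. Parametrizing \<open>c\<close> by \<open>\<sigma>\<close> makes the result depend on \<open>\<sigma>\<close> in a simple way; \<open>\<sigma> = 1\<close> is the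
total mass.
\<close>

lemma bessel_density_exp_moment:
  assumes k: "k > 1" and t: "t > 0" and \<sigma>: "\<sigma> > 0"
  shows "(\<integral>\<^sup>+y. ennreal (exp ((1 - 1 / \<sigma>) / (2 * t) * y\<^sup>2) * bessel_density k w t x y) \<partial>lborel) =
    ennreal (\<sigma> powr (k + 1/2) * exp ((\<sigma> - 1) * ((x\<^sup>2 / t + w\<^sup>2 * t) / 2)) *
      (bessel_J k (x * w * \<sigma>) 1 / bessel_J k (x * w) 1))"
proof -
  define \<kappa> where "\<kappa> = k + 1/2"
  define A where "A = 1 / (2 * t * \<sigma>)"
  have A: "A > 0" using t \<sigma> by (simp add: A_def)
  have J: "bessel_J k (x * w) 1 > 0" by (rule bessel_J_pos[OF k])
  have G: "Gamma \<kappa> > 0" using k by (auto simp: \<kappa>_def intro!: Gamma_real_pos)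
  define C where "C = exp (- (w\<^sup>2 * t / 2)) / ((2 * t) powr \<kappa> * Gamma \<kappa>) * exp (- (x\<^sup>2 / (2 * t))) / bessel_J k (x * w) 1"
  have C: "C \<ge> 0" unfolding C_def using J G by (intro divide_nonneg_nonneg mult_nonneg_nonneg) auto
  have integrand: "exp ((1 - 1 / \<sigma>) / (2 * t) * y\<^sup>2) * bessel_density k w t x y =
     C * (exp (- A * y\<^sup>2) * (bessel_J k (x / t * y) 1 * bessel_J k (w * y) 1) * \<bar>y\<bar> powr (2 * k))" for y
  proof -
    have "x / sqrt t * (y / sqrt t) = x / t * y" using t by (simp add: real_div_sqrt)
    then have J1: "bessel_J k (x / sqrt t) (y / sqrt t) = bessel_J k (x / t * y) 1"
      using bessel_J_mult[of k "x / sqrt t"] by metis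
    have J2: "bessel_J k y w = bessel_J k (w * y) 1" "bessel_J k x w = bessel_J k (x * w) 1"
      using bessel_J_mult[of k y w] bessel_J_mult[of k x w] by (simp_all only: mult.commute)
    have e: "exp ((1 - 1 / \<sigma>) / (2 * t) * y\<^sup>2) * exp (- ((x\<^sup>2 + y\<^sup>2) / (2 * t))) =
        exp (- (x\<^sup>2 / (2 * t))) * exp (- A * y\<^sup>2)"
      unfolding exp_add[symmetric] using t \<sigma> by (intro arg_cong[where f=exp]) (simp add: A_def field_simps)
    have "e1 * (c * (e2 * (j1 * j2 / j) * p)) = (c * (e1 * e2) / j) * ((j1 * j2) * p)" for e1 c e2 j1 j2 j p :: real
      by (simp add: mult_ac)
    then have "exp ((1 - 1 / \<sigma>) / (2 * t) * y\<^sup>2) * bessel_density k w t x y =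
       (exp (- (w\<^sup>2 * t / 2)) / ((2 * t) powr \<kappa> * Gamma \<kappa>) *
         (exp ((1 - 1 / \<sigma>) / (2 * t) * y\<^sup>2) * exp (- ((x\<^sup>2 + y\<^sup>2) / (2 * t)))) / bessel_J k (x * w) 1) *
       ((bessel_J k (x / t * y) 1 * bessel_J k (w * y) 1) * \<bar>y\<bar> powr (2 * k))"
      unfolding bessel_density_def J1 J2 \<kappa>_def[symmetric] .
    also have "\<dots> = C * (exp (- A * y\<^sup>2) * (bessel_J k (x / t * y) 1 * bessel_J k (w * y) 1) * \<bar>y\<bar> powr (2 * k))"
      unfolding e C_def by (simp only: divide_inverse mult_ac)
    finally show ?thesis .
  qed
  have Bw: "x / t * w / (2 * A) = x * w * \<sigma>" using t \<sigma> by (simp add: A_def)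
  have expo: "((x / t)\<^sup>2 + w\<^sup>2) / (4 * A) = \<sigma> * ((x\<^sup>2 / t + w\<^sup>2 * t) / 2)"
    using t \<sigma> by (simp add: A_def field_simps power2_eq_square)
  have Apow: "A powr - \<kappa> = (2 * t) powr \<kappa> * \<sigma> powr \<kappa>"
    using t \<sigma> by (simp add: A_def powr_minus powr_divide powr_mult)
  have "(\<integral>\<^sup>+y. ennreal (exp ((1 - 1 / \<sigma>) / (2 * t) * y\<^sup>2) * bessel_density k w t x y) \<partial>lborel) =
      (\<integral>\<^sup>+y. ennreal C * ennreal (exp (- A * y\<^sup>2) * (bessel_J k (x / t * y) 1 * bessel_J k (w * y) 1) * \<bar>y\<bar> powr (2 * k)) \<partial>lborel)"
    unfolding integrand ennreal_mult'[OF C] ..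
  also have "\<dots> = ennreal C * (\<integral>\<^sup>+y. ennreal (exp (- A * y\<^sup>2) * (bessel_J k (x / t * y) 1 * bessel_J k (w * y) 1) * \<bar>y\<bar> powr (2 * k)) \<partial>lborel)"
    by (rule nn_integral_cmult) simp
  also have "\<dots> = ennreal (C * (Gamma \<kappa> * A powr - \<kappa> * exp (((x / t)\<^sup>2 + w\<^sup>2) / (4 * A)) * bessel_J k (x / t * w / (2 * A)) 1))"
    unfolding weber_second_exponential_integral[OF k A] \<kappa>_def[symmetric] ennreal_mult'[OF C] ..
  also have "C * (Gamma \<kappa> * A powr - \<kappa> * exp (((x / t)\<^sup>2 + w\<^sup>2) / (4 * A)) * bessel_J k (x / t * w / (2 * A)) 1) =
     \<sigma> powr \<kappa> * exp ((\<sigma> - 1) * ((x\<^sup>2 / t + w\<^sup>2 * t) / 2)) * (bessel_J k (x * w * \<sigma>) 1 / bessel_J k (x * w) 1)"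
  proof -
    have ex: "exp (- (w\<^sup>2 * t / 2)) * exp (- (x\<^sup>2 / (2 * t))) * exp (\<sigma> * ((x\<^sup>2 / t + w\<^sup>2 * t) / 2)) =
        exp ((\<sigma> - 1) * ((x\<^sup>2 / t + w\<^sup>2 * t) / 2))"
      unfolding exp_add[symmetric] using t by (intro arg_cong[where f=exp]) (simp add: field_simps)
    have alg: "e1 / (p * g) * e2 / j * (g * (p * s) * e3 * j') = s * (e1 * e2 * e3) * (j' / j)"
      if "p \<noteq> 0" "g \<noteq> 0" for e1 p g e2 j s e3 j' :: real
      using that by simp
    show ?thesis
      unfolding Bw expo Apow C_def ex[symmetric] by (rule alg) (use t G in simp_all)
  qed
  finally show ?thesis unfolding \<kappa>_def .
qed

lemma bessel_density_total:
  assumes k: "k > 1" and t: "t > 0"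
  shows "(\<integral>\<^sup>+y. ennreal (bessel_density k w t x y) \<partial>lborel) = 1"
  using bessel_density_exp_moment[OF k t, of 1 w x] bessel_J_pos[OF k, of "x * w" 1] by simp

text \<open>
The exponent is linear in \<open>\<sigma> - 1\<close> up to errors of order \<open>k\<^sup>1\<^sup>/\<^sup>2 |\<sigma> - 1|\<close> and \<open>k (\<sigma> - 1)\<^sup>2\<close>. For the quotient of
Bessel functions this follows from \<open>bessel_J_jensen\<close> with base point \<open>k z \<sigma>\<close>, which bounds its
logarithm by \<open>k z (\<sigma> - 1) m(k z \<sigma>)\<close> for both signs of \<open>\<sigma> - 1\<close>; then \<open>m(k z \<sigma>)\<close> is
replaced by \<open>h z\<close>, and \<open>z h(z) = sqrt (z\<^sup>2 + 1) - 1\<close>.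
\<close>

lemma bessel_exp_moment_bound:
  assumes k: "k > 1" and \<sigma>: "\<sigma> > 0"
  shows "\<sigma> powr (k + 1/2) * exp ((\<sigma> - 1) * (k * \<beta>)) * (bessel_J k (k * z * \<sigma>) 1 / bessel_J k (k * z) 1)
    \<le> exp (k * ((\<sigma> - 1) * (\<beta> + sqrt (z\<^sup>2 + 1)) + (1 + \<bar>z\<bar>) * \<bar>\<sigma> - 1\<bar> / sqrt k + z\<^sup>2 * (\<sigma> - 1)\<^sup>2))"
proof -
  let ?m = "bessel_mean k (k * z * \<sigma>)"
  have "\<sigma> powr (k + 1/2) \<le> exp (\<sigma> - 1) powr (k + 1/2)"
    using k \<sigma> exp_ge_add_one_self[of "\<sigma> - 1"] by (intro powr_mono2) auto
  also have "\<dots> = exp ((k + 1/2) * (\<sigma> - 1))" by (simp add: powr_def)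
  finally have 1: "\<sigma> powr (k + 1/2) \<le> exp ((k + 1/2) * (\<sigma> - 1))" .
  have Jp: "bessel_J k (k * z) 1 > 0" by (rule bessel_J_pos[OF k])
  have "bessel_J k (k * z * \<sigma>) 1 * exp ((k * z - k * z * \<sigma>) * ?m) \<le> bessel_J k (k * z) 1"
    by (rule bessel_J_jensen[OF k])
  then have "bessel_J k (k * z * \<sigma>) 1 * (exp ((k * z - k * z * \<sigma>) * ?m) * exp ((k * z * \<sigma> - k * z) * ?m)) \<le>
     bessel_J k (k * z) 1 * exp ((k * z * \<sigma> - k * z) * ?m)"
    by (simp only: mult.assoc[symmetric]) (rule mult_right_mono, simp_all)
  moreover have "exp ((k * z - k * z * \<sigma>) * ?m) * exp ((k * z * \<sigma> - k * z) * ?m) = 1"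
    by (simp add: algebra_simps flip: exp_add)
  ultimately have "bessel_J k (k * z * \<sigma>) 1 \<le> bessel_J k (k * z) 1 * exp ((k * z * \<sigma> - k * z) * ?m)"
    by (simp only: mult_1_right)
  then have 2: "bessel_J k (k * z * \<sigma>) 1 / bessel_J k (k * z) 1 \<le> exp ((k * z * \<sigma> - k * z) * ?m)"
    by (subst pos_divide_le_eq[OF Jp]) (simp only: mult.commute)
  have "\<bar>?m - h_fun z\<bar> \<le> 1 / sqrt k + \<bar>z\<bar> * \<bar>\<sigma> - 1\<bar>"
  proof -
    have "\<bar>?m - h_fun (z * \<sigma>)\<bar> \<le> 1 / sqrt k"
      using bessel_mean_approx[OF k, of "z * \<sigma>"] by (simp add: mult.assoc)
    moreover have "\<bar>h_fun (z * \<sigma>) - h_fun z\<bar> \<le> \<bar>z * \<sigma> - z\<bar>" by (rule h_fun_lipschitz)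
    moreover have "\<bar>z * \<sigma> - z\<bar> = \<bar>z\<bar> * \<bar>\<sigma> - 1\<bar>"
      by (simp add: abs_mult[symmetric] algebra_simps)
    ultimately show ?thesis by linarith
  qed
  then have "\<bar>z * (\<sigma> - 1)\<bar> * \<bar>?m - h_fun z\<bar> \<le> \<bar>z * (\<sigma> - 1)\<bar> * (1 / sqrt k + \<bar>z\<bar> * \<bar>\<sigma> - 1\<bar>)"
    by (rule mult_left_mono) simp
  moreover have "z * (\<sigma> - 1) * (?m - h_fun z) \<le> \<bar>z * (\<sigma> - 1)\<bar> * \<bar>?m - h_fun z\<bar>"
    unfolding abs_mult[symmetric] by (rule abs_ge_self)
  moreover have "\<bar>z * (\<sigma> - 1)\<bar> * (1 / sqrt k + \<bar>z\<bar> * \<bar>\<sigma> - 1\<bar>) = \<bar>z\<bar> * \<bar>\<sigma> - 1\<bar> / sqrt k + z\<^sup>2 * (\<sigma> - 1)\<^sup>2"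
  proof -
    have "\<bar>z * (\<sigma> - 1)\<bar> * (1 / sqrt k + \<bar>z\<bar> * \<bar>\<sigma> - 1\<bar>) = \<bar>z\<bar> * \<bar>\<sigma> - 1\<bar> / sqrt k + \<bar>z\<bar>\<^sup>2 * \<bar>\<sigma> - 1\<bar>\<^sup>2"
      unfolding abs_mult power2_eq_square by (simp add: algebra_simps)
    then show ?thesis by simp
  qed
  moreover have "z * (\<sigma> - 1) * (?m - h_fun z) = z * (\<sigma> - 1) * ?m - (\<sigma> - 1) * (sqrt (z\<^sup>2 + 1) - 1)"
    unfolding h_fun_mult[symmetric] by (simp add: algebra_simps)
  ultimately have 3: "z * (\<sigma> - 1) * ?m \<le> (\<sigma> - 1) * (sqrt (z\<^sup>2 + 1) - 1) + \<bar>z\<bar> * \<bar>\<sigma> - 1\<bar> / sqrt k + z\<^sup>2 * (\<sigma> - 1)\<^sup>2"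
    by linarith
  have 4: "(\<sigma> - 1) / (2 * k) \<le> \<bar>\<sigma> - 1\<bar> / sqrt k"
  proof -
    have "sqrt k \<le> 2 * k" using k by (intro real_le_lsqrt) (auto simp: power2_eq_square)
    then have "\<bar>\<sigma> - 1\<bar> / (2 * k) \<le> \<bar>\<sigma> - 1\<bar> / sqrt k"
      using k by (intro divide_left_mono) auto
    moreover have "(\<sigma> - 1) / (2 * k) \<le> \<bar>\<sigma> - 1\<bar> / (2 * k)"
      using k by (intro divide_right_mono) auto
    ultimately show ?thesis by linarith
  qed
  have "\<sigma> powr (k + 1/2) * exp ((\<sigma> - 1) * (k * \<beta>)) * (bessel_J k (k * z * \<sigma>) 1 / bessel_J k (k * z) 1) \<le>
      exp ((k + 1/2) * (\<sigma> - 1)) * exp ((\<sigma> - 1) * (k * \<beta>)) * exp ((k * z * \<sigma> - k * z) * ?m)"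
    by (intro mult_mono 1 2 order_refl mult_nonneg_nonneg divide_nonneg_nonneg less_imp_le[OF bessel_J_pos[OF k]]) simp_all
  also have "\<dots> = exp (k * ((\<sigma> - 1) / (2 * k) + (\<sigma> - 1) + (\<sigma> - 1) * \<beta> + z * (\<sigma> - 1) * ?m))"
    unfolding exp_add[symmetric] using k by (intro arg_cong[where f=exp]) (simp add: field_simps)
  also have "\<dots> \<le> exp (k * ((\<sigma> - 1) * (\<beta> + sqrt (z\<^sup>2 + 1)) + (1 + \<bar>z\<bar>) * \<bar>\<sigma> - 1\<bar> / sqrt k + z\<^sup>2 * (\<sigma> - 1)\<^sup>2))"
  proof -
    have "(\<sigma> - 1) * (\<beta> + sqrt (z\<^sup>2 + 1)) = (\<sigma> - 1) + (\<sigma> - 1) * \<beta> + (\<sigma> - 1) * (sqrt (z\<^sup>2 + 1) - 1)"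
      by (simp add: algebra_simps)
    moreover have "(1 + \<bar>z\<bar>) * \<bar>\<sigma> - 1\<bar> / sqrt k = \<bar>\<sigma> - 1\<bar> / sqrt k + \<bar>z\<bar> * \<bar>\<sigma> - 1\<bar> / sqrt k"
      by (simp add: distrib_right add_divide_distrib)
    ultimately have "(\<sigma> - 1) / (2 * k) + (\<sigma> - 1) + (\<sigma> - 1) * \<beta> + z * (\<sigma> - 1) * ?m \<le>
       (\<sigma> - 1) * (\<beta> + sqrt (z\<^sup>2 + 1)) + (1 + \<bar>z\<bar>) * \<bar>\<sigma> - 1\<bar> / sqrt k + z\<^sup>2 * (\<sigma> - 1)\<^sup>2"
      using 3 4 by linarith
    then show ?thesis using k by (simp only: exp_le_cancel_iff) (rule mult_left_mono, simp_all)
  qed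
  finally show ?thesis .
qed

text \<open>
Chernoff's bound. The case \<open>\<sigma> > 1\<close> serves for sets on which \<open>y\<^sup>2\<close> is too large, \<open>\<sigma> < 1\<close> for sets on
which it is too small. To first order in \<open>\<sigma> - 1\<close> and up to
the error of order \<open>k\<^sup>-\<^sup>1\<^sup>/\<^sup>2\<close>, only the gain \<open>|\<sigma> - 1| \<epsilon> / (2t\<sigma>)\<close> remains, because the square of the limit point is exactly \<open>2t (\<beta> + sqrt (z\<^sup>2 + 1))\<close>.
\<close>

lemma bessel_density_tail:
  assumes k: "k > 1" and t: "t > 0" and \<sigma>: "\<sigma> > 0"
    and S: "S \<in> sets borel" "\<And>y. y \<in> S \<Longrightarrow> (\<sigma> - 1) * (y\<^sup>2 - (y_lim x w t)\<^sup>2) \<ge> \<bar>\<sigma> - 1\<bar> * \<epsilon>"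
  shows "(\<integral>\<^sup>+y. ennreal (bessel_density k (k * w) (t / k) x y) * indicator S y \<partial>lborel) \<le>
    ennreal (exp (k * ((\<sigma> - 1)\<^sup>2 / \<sigma> * ((y_lim x w t)\<^sup>2 / (2 * t)) + (1 + \<bar>x * w\<bar>) * \<bar>\<sigma> - 1\<bar> / sqrt k
       + (x * w)\<^sup>2 * (\<sigma> - 1)\<^sup>2 - \<bar>\<sigma> - 1\<bar> * \<epsilon> / (2 * t * \<sigma>))))"
proof -
  define Y where "Y = (y_lim x w t)\<^sup>2"
  define z where "z = x * w"
  define \<beta> where "\<beta> = (x\<^sup>2 / t + w\<^sup>2 * t) / 2"
  let ?f = "bessel_density k (k * w) (t / k) x"
  let ?\<theta> = "(1 - 1 / \<sigma>) / (2 * (t / k))"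
  have tk: "t / k > 0" using k t by simp
  define a where "a = \<bar>\<sigma> - 1\<bar> * \<epsilon> / (2 * t * \<sigma>)"
  define c where "c = ?\<theta> * Y + k * a"
  have Yt: "Y / (2 * t) = \<beta> + sqrt (z\<^sup>2 + 1)"
    unfolding Y_def y_lim_sq[OF t] \<beta>_def z_def using t
    by (simp add: field_simps power_mult_distrib power2_eq_square)
  have ge: "ennreal (?f y) * indicator S y \<le> ennreal (exp (- c)) * ennreal (exp (?\<theta> * y\<^sup>2) * ?f y)" for y
  proof (cases "y \<in> S")
    case True
    have "?\<theta> * y\<^sup>2 - ?\<theta> * Y = (k / (2 * t * \<sigma>)) * ((\<sigma> - 1) * (y\<^sup>2 - Y))"
      using k t \<sigma> by (simp add: field_simps)
    also have "\<dots> \<ge> (k / (2 * t * \<sigma>)) * (\<bar>\<sigma> - 1\<bar> * \<epsilon>)"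
      using k t \<sigma> S(2)[OF True] unfolding Y_def by (intro mult_left_mono) auto
    also have "(k / (2 * t * \<sigma>)) * (\<bar>\<sigma> - 1\<bar> * \<epsilon>) = k * a" by (simp add: a_def)
    finally have "1 \<le> exp (- c + ?\<theta> * y\<^sup>2)" by (simp add: c_def)
    then have "1 * ?f y \<le> exp (- c + ?\<theta> * y\<^sup>2) * ?f y"
      by (rule mult_right_mono) (rule bessel_density_nonneg[OF k tk])
    then have "?f y \<le> exp (- c) * (exp (?\<theta> * y\<^sup>2) * ?f y)"
      by (simp only: exp_add mult.assoc mult_1_left)
    then have "ennreal (?f y) \<le> ennreal (exp (- c) * (exp (?\<theta> * y\<^sup>2) * ?f y))"
      by (rule ennreal_leI)
    then show ?thesis using True by (simp add: ennreal_mult' del: exp_minus)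
  qed simp
  have "(\<integral>\<^sup>+y. ennreal (?f y) * indicator S y \<partial>lborel) \<le>
      (\<integral>\<^sup>+y. ennreal (exp (- c)) * ennreal (exp (?\<theta> * y\<^sup>2) * ?f y) \<partial>lborel)"
    by (intro nn_integral_mono ge)
  also have "\<dots> = ennreal (exp (- c)) * (\<integral>\<^sup>+y. ennreal (exp (?\<theta> * y\<^sup>2) * ?f y) \<partial>lborel)"
    by (rule nn_integral_cmult) simp
  also have "\<dots> = ennreal (exp (- c) * (\<sigma> powr (k + 1/2) * exp ((\<sigma> - 1) * ((x\<^sup>2 / (t / k) + (k * w)\<^sup>2 * (t / k)) / 2)) *
      (bessel_J k (x * (k * w) * \<sigma>) 1 / bessel_J k (x * (k * w)) 1)))"
    unfolding bessel_density_exp_moment[OF k tk \<sigma>] by (rule ennreal_mult'[symmetric]) simp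
  also have "\<dots> = ennreal (exp (- c) * (\<sigma> powr (k + 1/2) * exp ((\<sigma> - 1) * (k * \<beta>)) *
      (bessel_J k (k * z * \<sigma>) 1 / bessel_J k (k * z) 1)))"
  proof -
    have "(x\<^sup>2 / (t / k) + (k * w)\<^sup>2 * (t / k)) / 2 = k * \<beta>"
      using k t by (simp add: \<beta>_def field_simps power2_eq_square)
    moreover have "x * (k * w) = k * z" by (simp add: z_def)
    ultimately show ?thesis by (simp only:)
  qed
  also have "\<dots> \<le> ennreal (exp (- c) * exp (k * ((\<sigma> - 1) * (\<beta> + sqrt (z\<^sup>2 + 1)) + (1 + \<bar>z\<bar>) * \<bar>\<sigma> - 1\<bar> / sqrt k + z\<^sup>2 * (\<sigma> - 1)\<^sup>2)))"
    by (intro ennreal_leI mult_left_mono bessel_exp_moment_bound k \<sigma>) simp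
  also have "exp (- c) * exp (k * ((\<sigma> - 1) * (\<beta> + sqrt (z\<^sup>2 + 1)) + (1 + \<bar>z\<bar>) * \<bar>\<sigma> - 1\<bar> / sqrt k + z\<^sup>2 * (\<sigma> - 1)\<^sup>2)) =
     exp (k * ((\<sigma> - 1)\<^sup>2 / \<sigma> * (Y / (2 * t)) + (1 + \<bar>z\<bar>) * \<bar>\<sigma> - 1\<bar> / sqrt k + z\<^sup>2 * (\<sigma> - 1)\<^sup>2 - a))"
  proof -
    define r where "r = Y / (2 * t)"
    have "?\<theta> * Y = k * ((1 - 1 / \<sigma>) * r)" using k t by (simp add: r_def)
    then have c: "c = k * ((1 - 1 / \<sigma>) * r + a)" by (simp add: c_def algebra_simps)
    have "(\<sigma> - 1) * r - (1 - 1 / \<sigma>) * r = (\<sigma> - 1)\<^sup>2 / \<sigma> * r"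
      using \<sigma> by (simp add: field_simps power2_eq_square)
    moreover have "exp (- c) * exp (k * ((\<sigma> - 1) * r + p + q)) = exp (k * (((\<sigma> - 1) * r - (1 - 1 / \<sigma>) * r) + p + q - a))" for p q
      unfolding exp_add[symmetric] c by (simp add: algebra_simps)
    ultimately show ?thesis unfolding Yt[symmetric] r_def[symmetric] by (simp only:)
  qed
  finally show ?thesis unfolding Y_def z_def a_def .
qed

text \<open>
In \<open>bessel_density_tail\<close> take \<open>\<sigma> = 1 \<plusminus> \<delta>\<close> with a fixed \<open>\<delta>\<close> so small that the quadratic terms use up
at most half of the gain; the term of order \<open>k\<^sup>-\<^sup>1\<^sup>/\<^sup>2\<close> is negligible for large \<open>k\<close>, so the bound
decays exponentially in \<open>k\<close>.
\<close>

lemma bessel_density_tail_uniform: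
  assumes L: "L \<ge> 1" and \<epsilon>: "\<epsilon> > 0" and p: "p > 0"
  shows "\<forall>\<^sub>F k in at_top. \<forall>x w t. \<bar>x\<bar> \<le> L \<and> \<bar>w\<bar> \<le> L \<and> 1 / L \<le> t \<and> t \<le> L \<longrightarrow>
    (\<integral>\<^sup>+y. ennreal (bessel_density k (k * w) (t / k) x y) *
       indicator {y. \<epsilon> \<le> \<bar>y\<^sup>2 - (y_lim x w t)\<^sup>2\<bar>} y \<partial>lborel) \<le> ennreal p"
proof -
  define \<delta> where "\<delta> = min (1/2) (\<epsilon> / (42 * L ^ 5))"
  have \<delta>: "0 < \<delta>" "\<delta> \<le> 1/2" using \<epsilon> L by (auto simp: \<delta>_def)
  \<comment> \<open>the gain is at least \<open>4c\<close>, the quadratic terms take at most \<open>2c\<close> and the term of order \<open>k\<^sup>-\<^sup>1\<^sup>/\<^sup>2\<close> at most \<open>c\<close>\<close>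
  define c where "c = \<delta> * \<epsilon> / (12 * L)"
  have c: "c > 0" using \<delta> \<epsilon> L by (simp add: c_def)
  have "7 * L ^ 4 * \<delta> \<le> 7 * L ^ 4 * (\<epsilon> / (42 * L ^ 5))"
    using L by (intro mult_left_mono) (simp_all add: \<delta>_def)
  also have "\<dots> = \<epsilon> / (6 * L)" using L by (simp add: field_simps eval_nat_numeral)
  finally have "\<delta> * (7 * L ^ 4 * \<delta>) \<le> \<delta> * (\<epsilon> / (6 * L))" using \<delta> by (intro mult_left_mono) auto
  then have quad: "7 * L ^ 4 * \<delta>\<^sup>2 \<le> 2 * c" by (simp add: c_def power2_eq_square algebra_simps)
  have "\<forall>\<^sub>F k in at_top. k > 1 \<and> k \<ge> (24 * L ^ 3 / \<epsilon>)\<^sup>2 \<and> k \<ge> ln (2 / p) / c"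
    by (intro eventually_conj eventually_gt_at_top eventually_ge_at_top)
  then show ?thesis
  proof eventually_elim
    case (elim k)
    then have k: "k > 1" by blast
    have "24 * L ^ 3 / \<epsilon> \<le> sqrt k" using elim by (intro real_le_rsqrt) blast
    then have "24 * L ^ 3 \<le> \<epsilon> * sqrt k" using \<epsilon> by (simp add: field_simps)
    then have "2 * L\<^sup>2 / sqrt k \<le> \<epsilon> / (12 * L)"
      using k L by (simp add: field_simps eval_nat_numeral)
    then have "\<delta> * (2 * L\<^sup>2 / sqrt k) \<le> \<delta> * (\<epsilon> / (12 * L))" using \<delta> by (intro mult_left_mono) auto
    then have lin: "2 * L\<^sup>2 * \<delta> / sqrt k \<le> c" by (simp add: c_def mult_ac)
    have "ln (2 / p) \<le> k * c" using elim c by (simp add: field_simps)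
    then have "exp (- (k * c)) \<le> exp (- ln (2 / p))" by simp
    also have "\<dots> = p / 2" using p by (simp add: exp_minus)
    finally have small: "exp (- (k * c)) \<le> p / 2" .
    show ?case
    proof (intro allI impI, elim conjE)
      fix x w t :: real assume a: "\<bar>x\<bar> \<le> L" "\<bar>w\<bar> \<le> L" "1 / L \<le> t" "t \<le> L"
      note bd = y_lim_bounds[OF L a]
      let ?f = "\<lambda>y. ennreal (bessel_density k (k * w) (t / k) x y)"
      let ?Y = "(y_lim x w t)\<^sup>2"
      have one_sided: "(\<integral>\<^sup>+y. ?f y * indicator S y \<partial>lborel) \<le> ennreal (p / 2)"
        if \<sigma>: "\<bar>\<sigma> - 1\<bar> = \<delta>" and S: "S \<in> sets borel" "\<And>y. y \<in> S \<Longrightarrow> (\<sigma> - 1) * (y\<^sup>2 - ?Y) \<ge> \<bar>\<sigma> - 1\<bar> * \<epsilon>" for \<sigma> S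
      proof -
        have \<sigma>1: "1/2 \<le> \<sigma>" "\<sigma> \<le> 3/2" using \<sigma> \<delta> by linarith+
        have \<sigma>2: "(\<sigma> - 1)\<^sup>2 = \<delta>\<^sup>2" using \<sigma> by (metis power2_abs)
        have "(\<sigma> - 1)\<^sup>2 / \<sigma> * (?Y / (2 * t)) \<le> (\<delta>\<^sup>2 / (1/2)) * (3 * L ^ 3)"
          unfolding \<sigma>2 using \<sigma>1 bd L by (intro mult_mono divide_left_mono) auto
        also have "\<dots> = 6 * \<delta>\<^sup>2 * L ^ 3" by simp
        also have "\<dots> \<le> 6 * \<delta>\<^sup>2 * L ^ 4" using L by (intro mult_left_mono power_increasing) auto
        finally have 1: "(\<sigma> - 1)\<^sup>2 / \<sigma> * (?Y / (2 * t)) \<le> 6 * L ^ 4 * \<delta>\<^sup>2" by (simp only: mult_ac)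
        have L1: "1 \<le> L\<^sup>2" using L by (simp add: one_le_power)
        have "(1 + \<bar>x * w\<bar>) * \<delta> \<le> (2 * L\<^sup>2) * \<delta>"
          using bd(5) L1 \<delta> by (intro mult_right_mono) auto
        then have "(1 + \<bar>x * w\<bar>) * \<delta> / sqrt k \<le> 2 * L\<^sup>2 * \<delta> / sqrt k"
          using k by (intro divide_right_mono) auto
        with lin have 2: "(1 + \<bar>x * w\<bar>) * \<bar>\<sigma> - 1\<bar> / sqrt k \<le> c" unfolding \<sigma> by linarith
        have "\<bar>x * w\<bar>\<^sup>2 \<le> (L\<^sup>2)\<^sup>2" using bd(5) by (intro power_mono) auto
        then have "(x * w)\<^sup>2 \<le> L ^ 4" by (simp add: power2_abs flip: power_mult)
        then have 3: "(x * w)\<^sup>2 * (\<sigma> - 1)\<^sup>2 \<le> L ^ 4 * \<delta>\<^sup>2" unfolding \<sigma>2 by (intro mult_right_mono) auto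
        have "\<delta> * \<epsilon> / (3 * L) \<le> \<delta> * \<epsilon> / (2 * t * \<sigma>)"
        proof (rule divide_left_mono)
          have "t * \<sigma> \<le> L * (3/2)" using a \<sigma>1 bd(1) L by (intro mult_mono) auto
          then show "2 * t * \<sigma> \<le> 3 * L" by simp
        qed (use \<delta> \<epsilon> \<sigma>1 bd(1) L in auto)
        then have 4: "4 * c \<le> \<bar>\<sigma> - 1\<bar> * \<epsilon> / (2 * t * \<sigma>)" unfolding \<sigma> by (simp add: c_def)
        have "(\<sigma> - 1)\<^sup>2 / \<sigma> * (?Y / (2 * t)) + (1 + \<bar>x * w\<bar>) * \<bar>\<sigma> - 1\<bar> / sqrt k
           + (x * w)\<^sup>2 * (\<sigma> - 1)\<^sup>2 - \<bar>\<sigma> - 1\<bar> * \<epsilon> / (2 * t * \<sigma>) \<le> - c" (is "?E \<le> _")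
          using 1 2 3 4 quad by linarith
        then have "k * ?E \<le> k * (- c)" using k by (intro mult_left_mono) auto
        then have "exp (k * ?E) \<le> exp (- (k * c))" by simp
        then have "exp (k * ?E) \<le> p / 2" using small by linarith
        moreover have "(\<integral>\<^sup>+y. ?f y * indicator S y \<partial>lborel) \<le> ennreal (exp (k * ?E))"
          using \<sigma>1 by (intro bessel_density_tail k bd S) auto
        ultimately show ?thesis by (meson ennreal_leI order_trans)
      qed
      let ?U = "{y. ?Y + \<epsilon> \<le> y\<^sup>2}" and ?D = "{y. y\<^sup>2 \<le> ?Y - \<epsilon>}"
      have "(\<integral>\<^sup>+y. ?f y * indicator {y. \<epsilon> \<le> \<bar>y\<^sup>2 - ?Y\<bar>} y \<partial>lborel) \<le>
          (\<integral>\<^sup>+y. ?f y * indicator ?U y + ?f y * indicator ?D y \<partial>lborel)"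
        by (intro nn_integral_mono) (auto simp: indicator_def)
      also have "\<dots> = (\<integral>\<^sup>+y. ?f y * indicator ?U y \<partial>lborel) + (\<integral>\<^sup>+y. ?f y * indicator ?D y \<partial>lborel)"
        by (rule nn_integral_add) simp_all
      also have "\<dots> \<le> ennreal (p / 2) + ennreal (p / 2)"
      proof (intro add_mono)
        show "(\<integral>\<^sup>+y. ?f y * indicator ?U y \<partial>lborel) \<le> ennreal (p / 2)"
          by (rule one_sided[of "1 + \<delta>"]) (use \<delta> in auto)
        show "(\<integral>\<^sup>+y. ?f y * indicator ?D y \<partial>lborel) \<le> ennreal (p / 2)"
        proof (rule one_sided[of "1 - \<delta>"])
          fix y assume "y \<in> ?D"
          then have "\<delta> * \<epsilon> \<le> \<delta> * (?Y - y\<^sup>2)" using \<delta> by (intro mult_left_mono) auto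
          then show "\<bar>1 - \<delta> - 1\<bar> * \<epsilon> \<le> (1 - \<delta> - 1) * (y\<^sup>2 - ?Y)" using \<delta> by (simp add: algebra_simps)
        qed (use \<delta> in auto)
      qed
      also have "\<dots> = ennreal p" using p by (simp flip: ennreal_plus)
      finally show "(\<integral>\<^sup>+y. ?f y * indicator {y. \<epsilon> \<le> \<bar>y\<^sup>2 - ?Y\<bar>} y \<partial>lborel) \<le> ennreal p" .
    qed
  qed
qed

section \<open>Prohorov distance to a two-point measure\<close>

lemma nbhd_set_borel: "nbhd_set e B \<in> sets borel"
proof -
  have "nbhd_set e B = (\<Union>y\<in>B. ball y e)"
    by (auto simp: nbhd_set_def dist_commute)
  then show ?thesis by (simp add: borel_open open_UN)
qed

lemma measure_dirac_comb:
  assumes "A \<in> sets borel" "a \<ge> 0" "b \<ge> 0"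
  shows "measure (dirac_comb a y b z) A = a * indicator A y + b * indicator A z"
proof -
  have "emeasure (dirac_comb a y b z) A = ennreal (a * indicator A y + b * indicator A z)"
    unfolding emeasure_dirac_comb[OF assms(1)] using assms
    by (auto simp: indicator_def)
  then show ?thesis
    unfolding measure_def using assms by (simp only: enn2real_ennreal add_nonneg_nonneg mult_nonneg_nonneg indicator_pos_le)
qed

lemma prohorov_dist_leI:
  assumes "\<epsilon> > 0" "\<And>B. B \<in> sets borel \<Longrightarrow> measure M B \<le> measure N (nbhd_set \<epsilon> B) + \<epsilon>"
  shows "prohorov_dist M N \<le> \<epsilon>"
  unfolding prohorov_dist_def using assms
  by (intro cInf_lower bdd_belowI[of _ 0]) auto

text \<open>
A Borel set \<open>B\<close> collects mass from three regions: near \<open>z\<close>, near \<open>-z\<close>, and far from both. If \<open>B\<close>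
meets the region near \<open>z\<close>, its neighbourhood contains \<open>z\<close>, so the mass \<open>a\<close> on the right pays for
the mass near \<open>z\<close>, which is at most \<open>(1/2) 2 (a + e)\<close> by the symmetry of \<open>f\<close>; likewise for \<open>-z\<close>.
The far region contributes at most \<open>C p \<le> e\<close>. The three errors \<open>e\<close> give the bound \<open>3e\<close>.
\<close>

lemma prohorov_dist_two_peaks:
  fixes f \<rho> :: "real \<Rightarrow> real"
  assumes [measurable]: "f \<in> borel_measurable borel" "\<rho> \<in> borel_measurable borel"
    and f: "\<And>y. f y \<ge> 0" "\<And>y. f (- y) = f y" "(\<integral>\<^sup>+y. ennreal (f y) \<partial>lborel) = 1"
    and \<rho>: "\<And>y. \<rho> y \<ge> 0" "\<And>y. \<rho> y \<le> C"
    and nonneg: "a \<ge> 0" "b \<ge> 0" "e > 0"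
    and pos: "\<And>y. y > 0 \<Longrightarrow> \<bar>y\<^sup>2 - z\<^sup>2\<bar> < \<eta> \<Longrightarrow> \<bar>y - z\<bar> < e \<and> \<rho> y \<le> 2 * (a + e)"
    and neg: "\<And>y. y < 0 \<Longrightarrow> \<bar>y\<^sup>2 - z\<^sup>2\<bar> < \<eta> \<Longrightarrow> \<bar>y + z\<bar> < e \<and> \<rho> y \<le> 2 * (b + e)"
    and \<eta>: "\<eta> \<le> z\<^sup>2"
    and tail: "(\<integral>\<^sup>+y. ennreal (f y) * indicator {y. \<eta> \<le> \<bar>y\<^sup>2 - z\<^sup>2\<bar>} y \<partial>lborel) \<le> ennreal p" "p \<ge> 0" "C * p \<le> e"
  shows "prohorov_dist (density lborel (\<lambda>y. ennreal (f y * \<rho> y))) (dirac_comb a z b (- z)) \<le> 3 * e"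
proof (rule prohorov_dist_leI)
  show "3 * e > 0" using nonneg by simp
next
  fix B :: "real set" assume B [measurable]: "B \<in> sets borel"
  let ?N = "nbhd_set (3 * e) B"
  let ?P = "indicator ?N z :: real" and ?Q = "indicator ?N (- z) :: real"
  let ?far = "{y. \<eta> \<le> \<bar>y\<^sup>2 - z\<^sup>2\<bar>}"
  have C: "C \<ge> 0" using \<rho>(1)[of 0] \<rho>(2)[of 0] by linarith
  have PQ: "?P \<ge> 0" "?Q \<ge> 0" by simp_all
  have mem: "x \<in> ?N" if "y \<in> B" "\<bar>y - x\<bar> < e" for x y
    using that nonneg by (auto simp: nbhd_set_def dist_real_def intro!: bexI[of _ y])
  let ?A = "2 * (a + e) * ?P" and ?D = "2 * (b + e) * ?Q"
  have AD: "?A \<ge> 0" "?D \<ge> 0" using nonneg by simp_all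
  have pointwise: "ennreal (f y * \<rho> y) * indicator B y \<le>
      ennreal ?A * (ennreal (f y) * indicator {0<..} y) +
      ennreal ?D * (ennreal (f y) * indicator {..<0} y) +
      ennreal C * (ennreal (f y) * indicator ?far y)" for y
  proof (cases "y \<in> B")
    case True
    have le: "ennreal (f y * \<rho> y) \<le> ennreal c * ennreal (f y)" if "\<rho> y \<le> c" "c \<ge> 0" for c
    proof -
      have "f y * \<rho> y \<le> c * f y" using that f(1)[of y] by (simp add: mult.commute mult_right_mono)
      then show ?thesis using that by (simp add: ennreal_mult'[symmetric] ennreal_leI)
    qed
    \<comment> \<open>the point 0 is far from the peaks, because \<open>\<eta> \<le> z\<^sup>2\<close>\<close>
    consider "y \<in> ?far" | "y \<notin> ?far" "y > 0" | "y \<notin> ?far" "y < 0"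
    proof -
      have "y \<in> ?far" if "y = 0" using \<eta> that by simp
      then show thesis using that by (cases "y \<in> ?far"; cases y "0::real" rule: linorder_cases) blast+
    qed
    then show ?thesis
    proof cases
      case 1
      then have "ennreal (f y * \<rho> y) * indicator B y \<le> ennreal C * (ennreal (f y) * indicator ?far y)"
        using le[OF \<rho>(2) C] True by simp
      then show ?thesis by (rule order_trans) simp
    next
      case 2
      then have *: "\<bar>y - z\<bar> < e" "\<rho> y \<le> 2 * (a + e)" using pos[of y] by auto
      from mem[OF True *(1)] have "?A = 2 * (a + e)" by simp
      then have "ennreal (f y * \<rho> y) * indicator B y \<le> ennreal ?A * (ennreal (f y) * indicator {0<..} y)"
        using le[OF *(2)] nonneg True 2 by simp
      also have "\<dots> \<le> ennreal ?A * (ennreal (f y) * indicator {0<..} y) +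
          ennreal ?D * (ennreal (f y) * indicator {..<0} y)" by simp
      finally show ?thesis by (rule order_trans) simp
    next
      case 3
      then have *: "\<bar>y - (- z)\<bar> < e" "\<rho> y \<le> 2 * (b + e)" using neg[of y] by auto
      from mem[OF True *(1)] have "?D = 2 * (b + e)" by simp
      then have "ennreal (f y * \<rho> y) * indicator B y \<le> ennreal ?D * (ennreal (f y) * indicator {..<0} y)"
        using le[OF *(2)] nonneg True 3 by simp
      also have "\<dots> \<le> ennreal ?A * (ennreal (f y) * indicator {0<..} y) +
          ennreal ?D * (ennreal (f y) * indicator {..<0} y)" by simp
      finally show ?thesis by (rule order_trans) simp
    qed
  qed simp
  have fm: "(\<lambda>y. ennreal (f y)) \<in> borel_measurable borel" by simp
  define H where "H = (\<integral>\<^sup>+y. ennreal (f y) * indicator {0<..} y \<partial>lborel)"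
  have H2: "2 * H = 1"
    using nn_integral_even[OF fm] f(2,3) by (simp add: H_def)
  have H': "(\<integral>\<^sup>+y. ennreal (f y) * indicator {..<0} y \<partial>lborel) = H"
    unfolding H_def by (rule nn_integral_even_reflect[OF fm]) (simp add: f(2))
  have half: "ennreal (2 * c * r) * H = ennreal (c * r)" if "c \<ge> 0" "r \<ge> 0" for c r
  proof -
    have "ennreal (2 * c * r) = 2 * ennreal (c * r)"
      unfolding two_mult_ennreal by (simp only: mult.assoc)
    then have "ennreal (2 * c * r) * H = ennreal (c * r) * (2 * H)"
      by (simp only: mult_ac)
    then show ?thesis unfolding H2 by simp
  qed
  have halves: "ennreal ?A * H = ennreal ((a + e) * ?P)" "ennreal ?D * H = ennreal ((b + e) * ?Q)"
    by (rule half, use nonneg in simp, simp)+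
  have "emeasure (density lborel (\<lambda>y. ennreal (f y * \<rho> y))) B =
      (\<integral>\<^sup>+y. ennreal (f y * \<rho> y) * indicator B y \<partial>lborel)"
    by (rule emeasure_density) simp_all
  also have "\<dots> \<le> (\<integral>\<^sup>+y. ennreal ?A * (ennreal (f y) * indicator {0<..} y) +
      ennreal ?D * (ennreal (f y) * indicator {..<0} y) +
      ennreal C * (ennreal (f y) * indicator ?far y) \<partial>lborel)"
    by (intro nn_integral_mono pointwise)
  also have "\<dots> = ennreal ?A * H + ennreal ?D * H +
      ennreal C * (\<integral>\<^sup>+y. ennreal (f y) * indicator ?far y \<partial>lborel)"
    unfolding H'[symmetric]
    by (subst H') (simp add: nn_integral_add nn_integral_cmult H' H_def[symmetric])
  also have "\<dots> \<le> ennreal ((a + e) * ?P) + ennreal ((b + e) * ?Q) + ennreal C * ennreal p"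
    unfolding halves by (intro add_left_mono mult_left_mono tail) simp_all
  also have "\<dots> = ennreal ((a + e) * ?P + (b + e) * ?Q + C * p)"
    using nonneg PQ C tail(2) by (simp add: ennreal_mult)
  finally have "measure (density lborel (\<lambda>y. ennreal (f y * \<rho> y))) B \<le> (a + e) * ?P + (b + e) * ?Q + C * p"
    unfolding measure_def using nonneg PQ C tail(2) by (intro enn2real_leI) simp_all
  also have "\<dots> \<le> a * ?P + b * ?Q + 3 * e"
  proof -
    have "e * ?P \<le> e" "e * ?Q \<le> e" using nonneg by (auto simp: indicator_def)
    then show ?thesis using tail(3) by (simp add: distrib_right)
  qed
  also have "\<dots> = measure (dirac_comb a z b (- z)) ?N + 3 * e"
    using nonneg by (subst measure_dirac_comb) (simp_all add: nbhd_set_borel)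
  finally show "measure (density lborel (\<lambda>y. ennreal (f y * \<rho> y))) B \<le> measure (dirac_comb a z b (- z)) ?N + 3 * e" .
qed

section \<open>The two kernels as multiples of the symmetric kernel\<close>

lemma borel_measurable_dunkl_E [measurable]: "(\<lambda>y. dunkl_E k c (f y)) \<in> borel_measurable M"
  if [measurable]: "f \<in> borel_measurable M"
  unfolding dunkl_E_def set_lebesgue_integral_def by measurable

lemma borel_measurable_bessel_mean:
  assumes k: "k > 1" and [measurable]: "f \<in> borel_measurable M"
  shows "(\<lambda>y. bessel_mean k (f y)) \<in> borel_measurable M"
proof -
  have "bessel_mean k z = dunkl_E k 1 z / bessel_J k z 1 - 1" for z
    using bessel_J_pos[OF k, of z 1] dunkl_E_eq[OF k, of 1 z] bessel_J_commute[of k 1 z]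
    by (simp add: field_simps)
  then show ?thesis by simp
qed

text \<open>
After the rescaling \<open>w \<mapsto> kw\<close>, \<open>t \<mapsto> t/k\<close> every mean is taken at \<open>k\<close> times a quantity
that does not depend on \<open>k\<close>, which is the form required by \<open>bessel_mean_approx\<close>.
\<close>

lemma dunkl_kernel_eq_density:
  assumes k: "k > 1" and t: "t > 0"
  shows "dunkl_kernel k (k * w) (t / k) x = density lborel (\<lambda>y. ennreal (bessel_density k (k * w) (t / k) x y *
     ((1 + bessel_mean k (k * (x * y / t))) * (1 + bessel_mean k (k * (w * y))) / (1 + bessel_mean k (k * (x * w))))))"
    (is "_ = density lborel (\<lambda>y. ennreal (?f y * ?r y))")
    and dunkl_bessel_kernel_eq_density:
    "dunkl_bessel_kernel k (k * w) (t / k) x = density lborel (\<lambda>y. ennreal (bessel_density k (k * w) (t / k) x y *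
     (1 + bessel_mean k (k * (x * y / t)))))"
proof -
  have "x / sqrt (t / k) * (y / sqrt (t / k)) = k * (x * y / t)" for y
    using k t by (simp add: real_div_sqrt)
  then have E1: "dunkl_E k (x / sqrt (t / k)) (y / sqrt (t / k)) =
      bessel_J k (x / sqrt (t / k)) (y / sqrt (t / k)) * (1 + bessel_mean k (k * (x * y / t)))" for y
    unfolding dunkl_E_eq[OF k] by (simp only:)
  have "y * (k * w) = k * (w * y)" for y by simp
  then have E2: "dunkl_E k y (k * w) = bessel_J k y (k * w) * (1 + bessel_mean k (k * (w * y)))" for y
    unfolding dunkl_E_eq[OF k] by (simp only:)
  have alg: "c * (e * ((j1 * r1) * (j2 * r2) / (j3 * r3)) * p) = c * (e * (j1 * j2 / j3) * p) * (r1 * r2 / r3)"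
    for c e j1 r1 j2 r2 j3 r3 p :: real
    by (simp only: divide_inverse inverse_mult_distrib mult_ac)
  show "dunkl_kernel k (k * w) (t / k) x = density lborel (\<lambda>y. ennreal (?f y * ?r y))"
    unfolding dunkl_kernel_def bessel_density_def E1 E2 alg mult.commute[of w x] ..
  have alg: "c * (e * ((j1 * r1) * j2 / j3) * p) = c * (e * (j1 * j2 / j3) * p) * r1"
    for c e j1 r1 j2 j3 p :: real
    by (simp only: divide_inverse mult_ac)
  show "dunkl_bessel_kernel k (k * w) (t / k) x = density lborel (\<lambda>y. ennreal (?f y *
     (1 + bessel_mean k (k * (x * y / t)))))"
    unfolding dunkl_bessel_kernel_def bessel_density_def E1 alg ..
qed

lemma ratio_perturbation:
  fixes R1 R2 R3 U1 U2 U3 \<tau> r :: real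
  assumes "\<bar>R1 - U1\<bar> \<le> \<tau>" "\<bar>R2 - U2\<bar> \<le> \<tau>" "\<bar>R3 - U3\<bar> \<le> \<tau>"
    and "0 \<le> R1" "R1 \<le> 2" "0 \<le> U1" "U1 \<le> 2" "0 \<le> U2" "U2 \<le> 2"
    and r: "0 < r" "r \<le> 1/2" "r \<le> U3" "r / 2 \<le> R3"
  shows "R1 * R2 / R3 \<le> U1 * U2 / U3 + 12 * \<tau> / r\<^sup>2"
proof -
  have \<tau>: "\<tau> \<ge> 0" using assms(1) by linarith
  have pos: "R3 > 0" "U3 > 0" using r by linarith+
  have "R1 * (R2 - U2) \<le> 2 * \<tau>"
    using assms by (intro order_trans[OF mult_left_mono[of _ \<tau>] mult_right_mono[of R1 2 \<tau>]]) auto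
  moreover have "U2 * (R1 - U1) \<le> 2 * \<tau>"
    using assms by (intro order_trans[OF mult_left_mono[of _ \<tau>] mult_right_mono[of U2 2 \<tau>]]) auto
  ultimately have "R1 * R2 - U1 * U2 \<le> 4 * \<tau>" by (simp add: algebra_simps)
  then have "(R1 * R2 - U1 * U2) / R3 \<le> 4 * \<tau> / R3" using pos by (intro divide_right_mono) auto
  also have "\<dots> \<le> 4 * \<tau> / (r / 2)" using r \<tau> pos by (intro divide_left_mono) auto
  also have "\<dots> \<le> 4 * \<tau> / r\<^sup>2"
  proof (rule divide_left_mono)
    have "r * r \<le> r * (1/2)" using r by (intro mult_left_mono) auto
    then show "r\<^sup>2 \<le> r / 2" by (simp add: power2_eq_square)
  qed (use r \<tau> in auto)
  finally have 1: "(R1 * R2 - U1 * U2) / R3 \<le> 4 * \<tau> / r\<^sup>2" .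
  have "U1 * U2 \<le> 2 * 2" using assms by (intro mult_mono) auto
  moreover have "0 \<le> U1 * U2" using assms by simp
  ultimately have "U1 * U2 * (U3 - R3) \<le> 4 * \<tau>"
    using assms(3) \<tau> by (intro order_trans[OF mult_left_mono[of _ \<tau>] mult_right_mono[of _ 4 \<tau>]]) auto
  then have "U1 * U2 * (U3 - R3) / (R3 * U3) \<le> 4 * \<tau> / (R3 * U3)"
    using pos by (intro divide_right_mono) auto
  also have "\<dots> \<le> 4 * \<tau> / (r / 2 * r)"
    using r \<tau> pos by (intro divide_left_mono mult_mono mult_pos_pos) auto
  finally have 2: "U1 * U2 * (U3 - R3) / (R3 * U3) \<le> 8 * \<tau> / r\<^sup>2" by (simp add: power2_eq_square)
  have "R1 * R2 / R3 - U1 * U2 / U3 = (R1 * R2 - U1 * U2) / R3 + U1 * U2 * (U3 - R3) / (R3 * U3)"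
    using pos by (simp add: field_simps)
  also have "\<dots> \<le> 4 * \<tau> / r\<^sup>2 + 8 * \<tau> / r\<^sup>2" using 1 2 by linarith
  also have "\<dots> = 12 * \<tau> / r\<^sup>2" by (simp add: add_divide_distrib[symmetric])
  finally show ?thesis by linarith
qed

text \<open>
\<open>|u\<^sup>2 - z\<^sup>2| = |u - z| (u + z)\<close>, where \<open>u + z \<ge> 1/L\<close> for positive \<open>u\<close>.
\<close>

lemma near_peak:
  fixes L y z \<eta> :: real
  assumes L: "L \<ge> 1" and z: "1 / L \<le> z" and y: "\<bar>y\<^sup>2 - z\<^sup>2\<bar> < \<eta>"
  shows "y > 0 \<Longrightarrow> \<bar>y - z\<bar> \<le> L * \<eta>" "y < 0 \<Longrightarrow> \<bar>y + z\<bar> \<le> L * \<eta>"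
proof -
  have main: "\<bar>u - z\<bar> \<le> L * \<eta>" if "u > 0" "\<bar>u\<^sup>2 - z\<^sup>2\<bar> < \<eta>" for u
  proof -
    have "\<bar>u - z\<bar> * (1 / L) \<le> \<bar>u - z\<bar> * (u + z)"
      using z that by (intro mult_left_mono) auto
    also have "\<dots> = \<bar>(u - z) * (u + z)\<bar>"
    proof -
      have "1 / L > 0" using L by simp
      then have "u + z > 0" using that(1) z by linarith
      then show ?thesis by (simp add: abs_mult)
    qed
    also have "\<dots> = \<bar>u\<^sup>2 - z\<^sup>2\<bar>" by (simp add: algebra_simps power2_eq_square)
    finally have "\<bar>u - z\<bar> * (1 / L) \<le> \<eta>" using that(2) by linarith
    then show ?thesis using L by (simp add: field_simps)
  qed
  show "y > 0 \<Longrightarrow> \<bar>y - z\<bar> \<le> L * \<eta>" using main[of y] y by simp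
  show "y < 0 \<Longrightarrow> \<bar>y + z\<bar> \<le> L * \<eta>" using main[of "- y"] y by (simp add: abs_if split: if_splits)
qed

lemma bessel_mean_near:
  assumes k: "k > 1" and c: "\<bar>c\<bar> \<le> M" and y: "\<bar>y - y'\<bar> \<le> d"
  shows "\<bar>(1 + bessel_mean k (k * (c * y))) - (1 + h_fun (c * y'))\<bar> \<le> 1 / sqrt k + M * d"
proof -
  have "\<bar>bessel_mean k (k * (c * y)) - h_fun (c * y)\<bar> \<le> 1 / sqrt k" by (rule bessel_mean_approx[OF k])
  moreover have "\<bar>h_fun (c * y) - h_fun (c * y')\<bar> \<le> \<bar>c * y - c * y'\<bar>" by (rule h_fun_lipschitz)
  moreover have "\<bar>c * y - c * y'\<bar> = \<bar>c\<bar> * \<bar>y - y'\<bar>" by (simp add: abs_mult[symmetric] algebra_simps)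
  moreover have "\<bar>c\<bar> * \<bar>y - y'\<bar> \<le> M * d" using c y by (intro mult_mono) auto
  ultimately show ?thesis by linarith
qed

section \<open>Uniform convergence\<close>

text \<open>
Boundedness gives the upper bounds; the lower bound on \<open>t\<close> holds because the continuous function
\<open>t\<close> attains its minimum on the compact set, where it is positive.
\<close>

lemma compact_parameter_bounds:
  fixes U :: "(real \<times> real \<times> real) set"
  assumes "compact U" "U \<subseteq> UNIV \<times> UNIV \<times> {0<..}"
  obtains L where "L \<ge> 1" "\<And>x w t. (x, w, t) \<in> U \<Longrightarrow> \<bar>x\<bar> \<le> L \<and> \<bar>w\<bar> \<le> L \<and> 1 / L \<le> t \<and> t \<le> L"
proof (cases "U = {}")
  case False
  from compact_imp_bounded[OF assms(1)] obtain B where B: "\<And>p. p \<in> U \<Longrightarrow> norm p \<le> B"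
    unfolding bounded_iff by blast
  have "\<exists>p\<in>U. \<forall>q\<in>U. snd (snd p) \<le> snd (snd q)"
    by (intro continuous_attains_inf assms(1) False continuous_intros)
  then obtain p0 where p0: "p0 \<in> U" "\<And>p. p \<in> U \<Longrightarrow> snd (snd p0) \<le> snd (snd p)"
    by blast
  have t0: "snd (snd p0) > 0" using p0(1) assms(2) by auto
  define L where "L = max 1 (max B (1 / snd (snd p0)))"
  show thesis
  proof (rule that[of L])
    show "L \<ge> 1" by (simp add: L_def)
    fix x w t assume U: "(x, w, t) \<in> U"
    have n: "norm (x, w, t) \<le> L" using B[OF U] by (simp add: L_def)
    have "norm x \<le> norm (x, w, t)" "norm (w, t) \<le> norm (x, w, t)"
      using norm_fst_le[of x "(w, t)"] norm_snd_le[of "(w, t)" x] by simp_all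
    moreover have "norm w \<le> norm (w, t)" "norm t \<le> norm (w, t)"
      using norm_fst_le[of w t] norm_snd_le[of t w] by simp_all
    moreover have "1 / L \<le> t"
    proof -
      have "1 / L \<le> 1 / (1 / snd (snd p0))"
        using t0 by (intro divide_left_mono) (auto simp: L_def)
      then show ?thesis using p0(2)[OF U] by simp
    qed
    ultimately show "\<bar>x\<bar> \<le> L \<and> \<bar>w\<bar> \<le> L \<and> 1 / L \<le> t \<and> t \<le> L" using n by simp
  qed
qed (use that[of 1] in auto)

lemma tendsto_0_ennrealI:
  fixes f :: "'a \<Rightarrow> ennreal"
  assumes "\<And>e::real. e > 0 \<Longrightarrow> \<forall>\<^sub>F k in F. f k \<le> ennreal e"
  shows "(f \<longlongrightarrow> 0) F"
proof (rule order_tendstoI)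
  fix a :: ennreal assume "0 < a"
  then obtain e :: real where e: "e > 0" "ennreal e < a"
  proof (cases a)
    case (real r)
    with \<open>0 < a\<close> show thesis by (intro that[of "r / 2"]) (auto simp: ennreal_less_iff)
  next
    case top
    then show thesis by (intro that[of 1]) auto
  qed
  from assms[OF e(1)] show "\<forall>\<^sub>F k in F. f k < a"
    by eventually_elim (rule le_less_trans[OF _ e(2)])
qed simp

text \<open>
Apply \<open>prohorov_dist_two_peaks\<close> to the symmetric density and the two multipliers. The multipliers
are close to their limits near the peaks by \<open>bessel_mean_near\<close> and \<open>ratio_perturbation\<close>, and are
bounded everywhere by \<open>8/r\<close>, because their denominator stays away from 0.
\<close>

lemma kernels_prohorov_uniform:
  assumes L: "L \<ge> 1" and e: "e > 0"
  shows "\<forall>\<^sub>F k in at_top. \<forall>x w t. \<bar>x\<bar> \<le> L \<and> \<bar>w\<bar> \<le> L \<and> 1 / L \<le> t \<and> t \<le> L \<longrightarrow>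
    prohorov_dist (dunkl_kernel k (k * w) (t / k) x)
      (dirac_comb (q_dunkl x w t / (1 + q_dunkl x w t)) (y_lim x w t) (1 / (1 + q_dunkl x w t)) (- y_lim x w t)) \<le> 3 * e \<and>
    prohorov_dist (dunkl_bessel_kernel k (k * w) (t / k) x)
      (dirac_comb (q_dunkl_bessel x w t / (1 + q_dunkl_bessel x w t)) (y_lim x w t)
         (1 / (1 + q_dunkl_bessel x w t)) (- y_lim x w t)) \<le> 3 * e"
proof -
  \<comment> \<open>lower bound for \<open>1 + h(xw)\<close>, by \<open>h_fun_lower\<close> and \<open>|xw| \<le> L\<^sup>2\<close>\<close>
  define r where "r = 1 / (L\<^sup>2 + 2)"
  have L2: "2 \<le> L\<^sup>2 + 2" by simp
  have r: "0 < r" "r \<le> 1/2"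
    using divide_left_mono[OF L2, of 1] by (simp_all add: r_def add_nonneg_pos)
  \<comment> \<open>admissible error of each factor; \<open>ratio_perturbation\<close> turns it into the error \<open>e\<close> of the multiplier\<close>
  define \<tau> where "\<tau> = e * r\<^sup>2 / 12"
  have \<tau>: "\<tau> > 0" using e r by (simp add: \<tau>_def)
  \<comment> \<open>the three entries give \<open>\<eta> \<le> y\<^sup>2\<close>, distance less than \<open>e\<close> from the peak, and half of the error \<open>\<tau>\<close>; large \<open>k\<close> gives the other half\<close>
  define \<eta> where "\<eta> = min (1 / L) (min (e / (2 * L)) (\<tau> / (2 * L ^ 3)))"
  have \<eta>: "\<eta> > 0" "\<eta> \<le> 1 / L" using L e \<tau> by (auto simp: \<eta>_def)
  have "L * \<eta> \<le> L * (e / (2 * L))" using L by (intro mult_left_mono) (auto simp: \<eta>_def)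
  also have "\<dots> < e" using L e by simp
  finally have \<eta>e: "L * \<eta> < e" .
  have "L ^ 3 * \<eta> \<le> L ^ 3 * (\<tau> / (2 * L ^ 3))" using L by (intro mult_left_mono) (auto simp: \<eta>_def)
  then have \<eta>\<tau>: "L\<^sup>2 * (L * \<eta>) \<le> \<tau> / 2" using L by (simp add: power3_eq_cube power2_eq_square mult.assoc)
  have "\<forall>\<^sub>F k in at_top. k > 1 \<and> k \<ge> (2 / \<tau>)\<^sup>2 \<and> k \<ge> (2 / r)\<^sup>2"
    by (intro eventually_conj eventually_gt_at_top eventually_ge_at_top)
  moreover have "e * r / 8 > 0" using e r by simp
  from bessel_density_tail_uniform[OF L \<eta>(1) this]
  have "\<forall>\<^sub>F k in at_top. \<forall>x w t. \<bar>x\<bar> \<le> L \<and> \<bar>w\<bar> \<le> L \<and> 1 / L \<le> t \<and> t \<le> L \<longrightarrow>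
    (\<integral>\<^sup>+y. ennreal (bessel_density k (k * w) (t / k) x y) *
       indicator {y. \<eta> \<le> \<bar>y\<^sup>2 - (y_lim x w t)\<^sup>2\<bar>} y \<partial>lborel) \<le> ennreal (e * r / 8)" .
  ultimately show ?thesis
  proof eventually_elim
    case (elim k)
    then have k: "k > 1" by blast
    have root: "1 / sqrt k \<le> c / 2" if "k \<ge> (2 / c)\<^sup>2" "c > 0" for c
    proof -
      have "2 / c \<le> sqrt k" using that by (intro real_le_rsqrt) blast
      then show ?thesis using k that by (simp add: field_simps)
    qed
    have k\<tau>: "1 / sqrt k \<le> \<tau> / 2" and kr: "1 / sqrt k \<le> r / 2"
      using root[OF _ \<tau>] root[OF _ r(1)] elim by blast+
    show ?case
    proof (intro allI impI, elim conjE)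
      fix x w t :: real assume a: "\<bar>x\<bar> \<le> L" "\<bar>w\<bar> \<le> L" "1 / L \<le> t" "t \<le> L"
      note bd = y_lim_bounds[OF L a]
      define z where "z = y_lim x w t"
      define u v where "u = h_fun (x * z / t)" and "v = h_fun (w * z)"
      have uv: "\<bar>u\<bar> < 1" "\<bar>v\<bar> < 1" unfolding u_def v_def by (rule h_fun_bound)+
      let ?f = "bessel_density k (k * w) (t / k) x"
      let ?R1 = "\<lambda>y. 1 + bessel_mean k (k * (x * y / t))"
      let ?R2 = "\<lambda>y. 1 + bessel_mean k (k * (w * y))"
      let ?R3 = "1 + bessel_mean k (k * (x * w))"
      let ?U3 = "1 + h_fun (x * w)"
      have tk: "t / k > 0" using bd(1) k by simp
      have range: "0 \<le> 1 + bessel_mean k c \<and> 1 + bessel_mean k c \<le> 2" for c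
        using abs_bessel_mean_le_1[OF k, of c] by linarith
      have "r \<le> 1 / (\<bar>x * w\<bar> + 2)" unfolding r_def using bd(5) by (intro divide_left_mono) auto
      then have U3: "r \<le> ?U3" using h_fun_lower[of "x * w"] by linarith
      have R3: "\<bar>?R3 - ?U3\<bar> \<le> 1 / sqrt k" using bessel_mean_approx[OF k, of "x * w"] by simp
      then have R3_lower: "r / 2 \<le> ?R3" using kr U3 by linarith
      have R3\<tau>: "\<bar>?R3 - ?U3\<bar> \<le> \<tau>" using R3 k\<tau> \<tau> by linarith
      have L2: "L \<le> L\<^sup>2" using L by (simp add: power2_eq_square)
      have approx: "\<bar>?R1 y - (1 + h_fun (x * y' / t))\<bar> \<le> \<tau>" "\<bar>?R2 y - (1 + h_fun (w * y'))\<bar> \<le> \<tau>"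
        if "\<bar>y - y'\<bar> \<le> L * \<eta>" for y y'
      proof -
        have "\<bar>?R1 y - (1 + h_fun (x * y' / t))\<bar> \<le> 1 / sqrt k + L\<^sup>2 * (L * \<eta>)"
          using bessel_mean_near[OF k bd(6) that] by simp
        then show "\<bar>?R1 y - (1 + h_fun (x * y' / t))\<bar> \<le> \<tau>" using k\<tau> \<eta>\<tau> by linarith
        have "\<bar>?R2 y - (1 + h_fun (w * y'))\<bar> \<le> 1 / sqrt k + L\<^sup>2 * (L * \<eta>)"
          using a L2 by (intro bessel_mean_near[OF k _ that]) linarith
        then show "\<bar>?R2 y - (1 + h_fun (w * y'))\<bar> \<le> \<tau>" using k\<tau> \<eta>\<tau> by linarith
      qed
      have pos: "\<bar>?R1 y - (1 + u)\<bar> \<le> \<tau> \<and> \<bar>?R2 y - (1 + v)\<bar> \<le> \<tau> \<and> \<bar>y - z\<bar> < e"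
        if "y > 0" "\<bar>y\<^sup>2 - z\<^sup>2\<bar> < \<eta>" for y
      proof -
        have "\<bar>y - z\<bar> \<le> L * \<eta>" using near_peak(1)[OF L _ that(2,1)] bd(3) by (simp add: z_def)
        then show ?thesis using approx[of y z] \<eta>e unfolding u_def v_def by linarith
      qed
      have neg: "\<bar>?R1 y - (1 - u)\<bar> \<le> \<tau> \<and> \<bar>?R2 y - (1 - v)\<bar> \<le> \<tau> \<and> \<bar>y + z\<bar> < e"
        if "y < 0" "\<bar>y\<^sup>2 - z\<^sup>2\<bar> < \<eta>" for y
      proof -
        have d: "\<bar>y + z\<bar> \<le> L * \<eta>" using near_peak(2)[OF L _ that(2,1)] bd(3) by (simp add: z_def)
        then have "\<bar>y - (- z)\<bar> \<le> L * \<eta>" by simp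
        note approx[OF this]
        moreover have "h_fun (x * - z / t) = - u" "h_fun (w * - z) = - v"
          unfolding u_def v_def h_fun_minus[symmetric] by simp_all
        ultimately show ?thesis using d \<eta>e by simp
      qed
      have meas: "(\<lambda>y. bessel_mean k (k * (x * y / t))) \<in> borel_measurable borel"
        "(\<lambda>y. bessel_mean k (k * (w * y))) \<in> borel_measurable borel"
        by (intro borel_measurable_bessel_mean[OF k]; measurable)+
      have meas_R: "(\<lambda>y. ?R1 y * ?R2 y / ?R3) \<in> borel_measurable borel" "?R1 \<in> borel_measurable borel"
        by (intro borel_measurable_divide borel_measurable_times borel_measurable_add borel_measurable_const meas)+
      have tail: "(\<integral>\<^sup>+y. ennreal (?f y) * indicator {y. \<eta> \<le> \<bar>y\<^sup>2 - z\<^sup>2\<bar>} y \<partial>lborel) \<le> ennreal (e * r / 8)"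
        unfolding z_def using elim a by blast
      have err: "12 * \<tau> / r\<^sup>2 = e" using r by (simp add: \<tau>_def)
      have \<tau>e: "\<tau> \<le> 2 * e"
      proof -
        have "r\<^sup>2 \<le> 1" using r by (intro power_le_one) auto
        then have "e * r\<^sup>2 \<le> e * 1" using e by (intro mult_left_mono) auto
        then show ?thesis using e by (simp add: \<tau>_def)
      qed
      have qd: "q_dunkl x w t > 0" "q_dunkl_bessel x w t > 0"
        using h_fun_bound[of "x * y_lim x w t / t"] h_fun_bound[of "w * y_lim x w t"]
        unfolding q_dunkl_def q_dunkl_bessel_def h_tilde_def
        by (auto intro!: mult_pos_pos divide_pos_pos simp: abs_less_iff)
      note f = bessel_density_nonneg[OF k tk] bessel_density_minus[OF k] bessel_density_total[OF k tk]
      have \<eta>z: "\<eta> \<le> z\<^sup>2" using \<eta>(2) bd(4) by (simp add: z_def)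
      have p: "e * r / 8 \<ge> 0" "(8 / r) * (e * r / 8) \<le> e" using e r by simp_all
      have r8: "8 / r \<ge> 2" using r by (simp add: field_simps)
      show "prohorov_dist (dunkl_kernel k (k * w) (t / k) x)
         (dirac_comb (q_dunkl x w t / (1 + q_dunkl x w t)) (y_lim x w t) (1 / (1 + q_dunkl x w t)) (- y_lim x w t)) \<le> 3 * e \<and>
        prohorov_dist (dunkl_bessel_kernel k (k * w) (t / k) x)
         (dirac_comb (q_dunkl_bessel x w t / (1 + q_dunkl_bessel x w t)) (y_lim x w t)
         (1 / (1 + q_dunkl_bessel x w t)) (- y_lim x w t)) \<le> 3 * e"
      proof (rule conjI)
        note W = weights_dunkl[OF bd(1), of x w, folded z_def, folded u_def v_def]
        show "prohorov_dist (dunkl_kernel k (k * w) (t / k) x)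
         (dirac_comb (q_dunkl x w t / (1 + q_dunkl x w t)) (y_lim x w t) (1 / (1 + q_dunkl x w t)) (- y_lim x w t)) \<le> 3 * e"
          unfolding dunkl_kernel_eq_density[OF k bd(1)] z_def[symmetric]
        proof (rule prohorov_dist_two_peaks[OF borel_measurable_bessel_density meas_R(1) f _ _ _ _ e _ _ \<eta>z tail p])
          fix y :: real
          show "0 \<le> ?R1 y * ?R2 y / ?R3"
            using range by (intro divide_nonneg_nonneg mult_nonneg_nonneg) blast+
          have "?R1 y * ?R2 y \<le> 2 * 2" using range by (intro mult_mono) auto
          then have "?R1 y * ?R2 y / ?R3 \<le> 4 / (r / 2)"
            using r R3_lower by (intro frac_le) auto
          then show "?R1 y * ?R2 y / ?R3 \<le> 8 / r" by simp
          show "\<bar>y - z\<bar> < e \<and> ?R1 y * ?R2 y / ?R3 \<le> 2 * (q_dunkl x w t / (1 + q_dunkl x w t) + e)"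
            if "y > 0" "\<bar>y\<^sup>2 - z\<^sup>2\<bar> < \<eta>"
          proof -
            have "?R1 y * ?R2 y / ?R3 \<le> (1 + u) * (1 + v) / ?U3 + 12 * \<tau> / r\<^sup>2"
              using pos[OF that] uv range by (intro ratio_perturbation R3\<tau> r U3 R3_lower) auto
            moreover have "2 * (q_dunkl x w t / (1 + q_dunkl x w t) + e) = (1 + u) * (1 + v) / ?U3 + 2 * e"
              unfolding W(1)[symmetric] by (rule distrib_left)
            ultimately show ?thesis using pos[OF that] e err by linarith
          qed
          show "\<bar>y + z\<bar> < e \<and> ?R1 y * ?R2 y / ?R3 \<le> 2 * (1 / (1 + q_dunkl x w t) + e)"
            if "y < 0" "\<bar>y\<^sup>2 - z\<^sup>2\<bar> < \<eta>"
          proof -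
            have "?R1 y * ?R2 y / ?R3 \<le> (1 - u) * (1 - v) / ?U3 + 12 * \<tau> / r\<^sup>2"
              using neg[OF that] uv range by (intro ratio_perturbation R3\<tau> r U3 R3_lower) auto
            moreover have "2 * (1 / (1 + q_dunkl x w t) + e) = (1 - u) * (1 - v) / ?U3 + 2 * e"
              unfolding W(2)[symmetric] by (rule distrib_left)
            ultimately show ?thesis using neg[OF that] e err by linarith
          qed
        qed (use qd in simp_all)
        note W = weights_dunkl_bessel[of x w t, folded z_def, folded u_def]
        show "prohorov_dist (dunkl_bessel_kernel k (k * w) (t / k) x)
         (dirac_comb (q_dunkl_bessel x w t / (1 + q_dunkl_bessel x w t)) (y_lim x w t)
         (1 / (1 + q_dunkl_bessel x w t)) (- y_lim x w t)) \<le> 3 * e"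
          unfolding dunkl_bessel_kernel_eq_density[OF k bd(1)] z_def[symmetric]
        proof (rule prohorov_dist_two_peaks[OF borel_measurable_bessel_density meas_R(2) f _ _ _ _ e _ _ \<eta>z tail p])
          fix y :: real
          show "0 \<le> ?R1 y" "?R1 y \<le> 8 / r" using range[of "k * (x * y / t)"] r8 by linarith+
          show "\<bar>y - z\<bar> < e \<and> ?R1 y \<le> 2 * (q_dunkl_bessel x w t / (1 + q_dunkl_bessel x w t) + e)"
            if "y > 0" "\<bar>y\<^sup>2 - z\<^sup>2\<bar> < \<eta>"
            unfolding distrib_left W(1) using pos[OF that] \<tau>e by linarith
          show "\<bar>y + z\<bar> < e \<and> ?R1 y \<le> 2 * (1 / (1 + q_dunkl_bessel x w t) + e)"
            if "y < 0" "\<bar>y\<^sup>2 - z\<^sup>2\<bar> < \<eta>"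
            unfolding distrib_left W(2) using neg[OF that] \<tau>e by linarith
        qed (use qd in simp_all)
      qed
    qed
  qed
qed

theorem theorem6p5:
  fixes U :: "(real \<times> real \<times> real) set"
  assumes "compact U"
    and "U \<subseteq> UNIV \<times> UNIV \<times> {0<..}"
  shows "((\<lambda>k::real. SUP (x, w, t)\<in>U. ennreal (prohorov_dist
            (dunkl_kernel k (k * w) (t / k) x)
            (dirac_comb (q_dunkl x w t / (1 + q_dunkl x w t)) (y_lim x w t)
                        (1 / (1 + q_dunkl x w t)) (- y_lim x w t))))
          \<longlongrightarrow> 0) at_top
       \<and> ((\<lambda>k::real. SUP (x, w, t)\<in>U. ennreal (prohorov_dist
            (dunkl_bessel_kernel k (k * w) (t / k) x)
            (dirac_comb (q_dunkl_bessel x w t / (1 + q_dunkl_bessel x w t)) (y_lim x w t)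
                        (1 / (1 + q_dunkl_bessel x w t)) (- y_lim x w t))))
          \<longlongrightarrow> 0) at_top"
proof -
  obtain L where L: "L \<ge> 1"
    and U: "\<And>x w t. (x, w, t) \<in> U \<Longrightarrow> \<bar>x\<bar> \<le> L \<and> \<bar>w\<bar> \<le> L \<and> 1 / L \<le> t \<and> t \<le> L"
    using compact_parameter_bounds[OF assms] by metis
  show ?thesis
  proof (intro conjI tendsto_0_ennrealI)
    fix e :: real assume "e > 0"
    then have "e / 3 > 0" by simp
    note ev = kernels_prohorov_uniform[OF L this]
    show "\<forall>\<^sub>F k in at_top. (SUP (x, w, t)\<in>U. ennreal (prohorov_dist
            (dunkl_kernel k (k * w) (t / k) x)
            (dirac_comb (q_dunkl x w t / (1 + q_dunkl x w t)) (y_lim x w t)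
                        (1 / (1 + q_dunkl x w t)) (- y_lim x w t)))) \<le> ennreal e"
      using ev by eventually_elim (use U in \<open>auto intro!: SUP_least ennreal_leI\<close>)
    show "\<forall>\<^sub>F k in at_top. (SUP (x, w, t)\<in>U. ennreal (prohorov_dist
            (dunkl_bessel_kernel k (k * w) (t / k) x)
            (dirac_comb (q_dunkl_bessel x w t / (1 + q_dunkl_bessel x w t)) (y_lim x w t)
                        (1 / (1 + q_dunkl_bessel x w t)) (- y_lim x w t)))) \<le> ennreal e"
      using ev by eventually_elim (use U in \<open>auto intro!: SUP_least ennreal_leI\<close>)
  qed
qed

end
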